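(* Let $0\le\varepsilon<1$, and let $\mathbf{V}=\{V^n\}_{n=1}^\infty$ and $\mathbf{W}=\{W^n\}_{n=1}^\infty$ be a general source and a general channel, respectively. Suppose there exist some channel input $\mathbf{X}=\{X^n\}_{n=1}^\infty$, which may be arbitrarily correlated to the output of the source $\mathbf{V}$, and some sequence $\{\gamma_n\}_{n=1}^\infty$ of real numbers with $$\gamma_n>0,\quad \gamma_n\to0\quad\text{and}\quad n\gamma_n\to\infty\qquad(n\to\infty)$$ for which $$\limsup_{n\to\infty}\Pr\left\{\frac1n\log\frac{W^n(Y^n|X^n)}{P_{Y^n}(Y^n)}\le\frac1n\log\frac1{P_{V^n}(V^n)}+\gamma_n\right\}\le\varepsilon,$$ where $Y^n$ is the channel output via $W^n$ due to the channel input $X^n$. Then the source $\mathbf{V}$ is $\varepsilon$-transmissible over the channel $\mathbf{W}$.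
   Context: A general source $\mathbf{V}=\{V^n\}_{n=1}^\infty$ is an arbitrary sequence of random variables $V^n=(V_1^{(n)},\dots,V_n^{(n)})$ with values in $\mathcal{V}^n$, where the source alphabet $\mathcal{V}$ is a countably infinite set; no consistency between different $n$ is required. A general channel $\mathbf{W}=\{W^n(\cdot|\cdot):\mathcal{X}^n\to\mathcal{Y}^n\}_{n=1}^\infty$ is an arbitrary sequence of transition probabilities (Markov kernels) $W^n$ from $\mathcal{X}^n$ to $\mathcal{Y}^n$, where $\mathcal{X},\mathcal{Y}$ are arbitrary abstract (measurable) alphabets. $P_Z$ denotes the distribution of $Z$. Logarithms are natural. A channel input $\mathbf{X}=\{X^n\}$ is a sequence of random variables $X^n$ with values in $\mathcal{X}^n$. "$Y^n$ is the channel output via $W^n$ due to the input $X^n$" means that the conditional distribution of $Y^n$ given $X^n=\mathbf{x}$ is $W^n(\cdot|\mathbf{x})$ and $V^n\to X^n\to Y^n$ is a Markov chain. For abstract alphabets, $\frac{W^n(Y^n|X^n)}{P_{Y^n}(Y^n)}$ means $g(Y^n|X^n)$, where $g(\mathbf{y}|\mathbf{x})=\frac{W^n(d\mathbf{y}|\mathbf{x})}{P_{Y^n}(d\mathbf{y})}=\frac{P_{X^nY^n}(d\mathbf{x},d\mathbf{y})}{P_{X^n}(d\mathbf{x})P_{Y^n}(d\mathbf{y})}$ is the Radon-Nikodym derivative, measurable in $(\mathbf{x},\mathbf{y})$. A joint source-channel $(n,\varepsilon_n)$ code is a pair of an encoder $\varphi_n:\mathcal{V}^n\to\mathcal{X}^n$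 and a decoder $\psi_n:\mathcal{Y}^n\to\mathcal{V}^n$ (deterministic maps) whose probability of decoding error is $\varepsilon_n=\sum_{\mathbf{v}\in\mathcal{V}^n}P_{V^n}(\mathbf{v})\,W^n(\mathcal{D}^c(\mathbf{v})|\varphi_n(\mathbf{v}))$, where $\mathcal{D}(\mathbf{v})=\{\mathbf{y}\in\mathcal{Y}^n:\psi_n(\mathbf{y})=\mathbf{v}\}$. The source $\mathbf{V}$ is $\varepsilon$-transmissible over the channel $\mathbf{W}$ if there exists a sequence of $(n,\varepsilon_n)$ codes with $\limsup_{n\to\infty}\varepsilon_n\le\varepsilon$. *)

theory Defs
  imports "HOL-Probability.Probability"
begin

text \<open>A block of length \<open>n\<close> over an alphabet is a function on the index set \<open>{..<n}\<close>
  (\<open>undefined\<close> elsewhere).  For abstract alphabets only the \<open>space\<close> and \<open>sets\<close> components of the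
  measure parameter matter; the block space carries the product \<open>\<sigma>\<close>-algebra.\<close>

definition blocks :: "nat \<Rightarrow> 'v set \<Rightarrow> (nat \<Rightarrow> 'v) set" where
  "blocks n A = (\<Pi>\<^sub>E i\<in>{..<n}. A)"

definition block_space :: "nat \<Rightarrow> 'a measure \<Rightarrow> (nat \<Rightarrow> 'a) measure" where
  "block_space n M = (\<Pi>\<^sub>M i\<in>{..<n}. M)"

lemma block_space_count_space:
  assumes "countable A"
  shows "block_space n (count_space A) = count_space (blocks n A)"
  unfolding block_space_def blocks_def by (rule count_space_PiM_finite) (auto simp: assms)


definition elog :: "ennreal \<Rightarrow> ereal" where
  "elog t = (if t = 0 then -\<infinity> else if t = \<infinity> then \<infinity> else ereal (ln (enn2real t)))"


text \<open>\<open>g\<close> is a version of the Radon-Nikodym derivative \<open>dN/dM\<close>.  If \<open>N\<close> is not absolutely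
  continuous with respect to \<open>M\<close> (which can happen for the joint law of input and output versus the
  product of its marginals, e.g. for a noiseless channel on an uncountable alphabet), then \<open>g\<close> is
  the density of the absolutely continuous part and takes the usual value \<open>\<infinity>\<close> on an \<open>M\<close>-null set
  carrying the singular part.  The two lemmas show that this is the ordinary notion in the
  absolutely continuous case and that such a \<open>g\<close> always exists for finite \<open>N\<close>.\<close>

definition is_RN_derivative :: "'a measure \<Rightarrow> 'a measure \<Rightarrow> ('a \<Rightarrow> ennreal) \<Rightarrow> bool" where
  "is_RN_derivative M N g \<longleftrightarrow>
     g \<in> borel_measurable M \<and>
     (\<exists>S\<in>null_sets M. (\<forall>x\<in>S. g x = \<infinity>) \<and>
        (\<forall>A\<in>sets M. emeasure N A = emeasure (density M g) A + emeasure N (A \<inter> S)))"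

lemma is_RN_derivative_absolutely_continuous:
  assumes "absolutely_continuous M N" and sets: "sets N = sets M"
  shows "is_RN_derivative M N g \<longleftrightarrow> g \<in> borel_measurable M \<and> density M g = N"
proof
  assume "is_RN_derivative M N g"
  then obtain S where g: "g \<in> borel_measurable M" and S: "S \<in> null_sets M"
    and eq: "\<And>A. A \<in> sets M \<Longrightarrow> emeasure N A = emeasure (density M g) A + emeasure N (A \<inter> S)"
    unfolding is_RN_derivative_def by blast
  have "density M g = N"
  proof (rule measure_eqI)
    fix A assume "A \<in> sets (density M g)"
    then have A: "A \<in> sets M" by simp
    have "A \<inter> S \<in> null_sets M" using S A by (rule null_set_Int1)
    then have "emeasure N (A \<inter> S) = 0"
      using assms(1) unfolding absolutely_continuous_def by (auto dest: null_setsD1)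
    then show "emeasure (density M g) A = emeasure N A" using eq[OF A] by simp
  qed (simp add: sets)
  with g show "g \<in> borel_measurable M \<and> density M g = N" by simp
next
  assume "g \<in> borel_measurable M \<and> density M g = N"
  then show "is_RN_derivative M N g"
    unfolding is_RN_derivative_def by (intro conjI bexI[of _ "{}"]) auto
qed

lemma is_RN_derivative_exists:
  assumes "sigma_finite_measure M" and "finite_measure N" and sets: "sets N = sets M"
  shows "\<exists>g. is_RN_derivative M N g"
proof -
  interpret M: sigma_finite_measure M by fact
  interpret N: finite_measure N by fact
  define s where "s = (SUP A\<in>null_sets M. emeasure N A)"
  have "null_sets M \<noteq> {}" by auto
  then obtain f :: "nat \<Rightarrow> ennreal" where f: "range f \<subseteq> emeasure N ` null_sets M" "s = (SUP i. f i)"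
    using ennreal_SUP_countable_SUP[of "null_sets M" "emeasure N"] unfolding s_def by blast
  then have "\<forall>i. \<exists>A\<in>null_sets M. f i = emeasure N A" by blast
  then obtain A where A: "\<And>i::nat. A i \<in> null_sets M" "\<And>i. f i = emeasure N (A i)" by metis
  define S where "S = (\<Union>i. A i)"
  have S: "S \<in> null_sets M" unfolding S_def using A(1) by auto
  then have SM: "S \<in> sets M" and SN: "S \<in> sets N" using sets by auto
  have "s \<le> emeasure N S" unfolding f(2) A(2)
    by (intro SUP_least emeasure_mono SN) (auto simp: S_def)
  have max: "emeasure N (B - S) = 0" if B: "B \<in> null_sets M" for B
  proof -
    have "emeasure N S + emeasure N (B - S) = emeasure N (S \<union> (B - S))"
      using B SN sets by (intro plus_emeasure) auto
    also have "\<dots> \<le> s" unfolding s_def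
      using null_sets.Un[OF S B] by (intro SUP_upper) simp
    also have "\<dots> \<le> emeasure N S" by fact
    finally have "emeasure N S + emeasure N (B - S) \<le> emeasure N S + 0" by simp
    then show ?thesis
      using N.emeasure_finite[of S] by (subst (asm) ennreal_add_left_cancel_le) auto
  qed
  define K where "K = density N (indicator (space M - S))"
  have spM: "space N = space M" using sets by (rule sets_eq_imp_space_eq)
  have K: "emeasure K B = emeasure N (B - S)" if "B \<in> sets M" for B
  proof -
    have "emeasure K B = emeasure N ((space M - S) \<inter> B)" unfolding K_def
      using that SM sets by (subst emeasure_restricted) auto
    also have "(space M - S) \<inter> B = B - S" using sets.sets_into_space[OF that] by auto
    finally show ?thesis .
  qed
  have "absolutely_continuous M K"
    unfolding absolutely_continuous_def
    using K max sets by (auto simp: null_sets_def K_def)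
  moreover have "sets K = sets M" by (simp add: K_def sets)
  ultimately obtain h where h: "h \<in> borel_measurable M" "density M h = K"
    using M.Radon_Nikodym by auto
  define g where "g x = (if x \<in> S then \<infinity> else h x)" for x
  have g: "g \<in> borel_measurable M" unfolding g_def using h(1) SM by measurable
  have "AE x in M. h x = g x" using AE_not_in[OF S] by eventually_elim (simp add: g_def)
  then have "density M g = K" using h g density_cong[of h M g] by simp
  then have "emeasure N B = emeasure (density M g) B + emeasure N (B \<inter> S)" if "B \<in> sets M" for B
  proof -
    have "emeasure N (B - S) + emeasure N (B \<inter> S) = emeasure N ((B - S) \<union> (B \<inter> S))"
      using that SM sets by (intro plus_emeasure) auto
    then show ?thesis using K[OF that] \<open>density M g = K\<close> by (simp add: Un_Diff_Int)
  qed
  then have "is_RN_derivative M N g"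
    unfolding is_RN_derivative_def using g S by (auto simp: g_def intro!: bexI[of _ S])
  then show ?thesis by blast
qed


definition cond_prob_given ::
    "'o measure \<Rightarrow> 'a measure \<Rightarrow> ('o \<Rightarrow> 'a) \<Rightarrow> 'o set \<Rightarrow> 'o \<Rightarrow> real" where
  "cond_prob_given \<Omega> M Z E = real_cond_exp \<Omega> (vimage_algebra (space \<Omega>) Z M) (indicator E)"

definition has_cond_distribution ::
    "'o measure \<Rightarrow> 'a measure \<Rightarrow> ('o \<Rightarrow> 'a) \<Rightarrow> 'b measure \<Rightarrow> ('o \<Rightarrow> 'b) \<Rightarrow> ('a \<Rightarrow> 'b measure) \<Rightarrow> bool" where
  "has_cond_distribution \<Omega> M X N Y W \<longleftrightarrow>
     (\<forall>B\<in>sets N. AE \<omega> in \<Omega>.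
        cond_prob_given \<Omega> M X (Y -` B \<inter> space \<Omega>) \<omega> = measure (W (X \<omega>)) B)"

definition markov_chain3 ::
    "'o measure \<Rightarrow> 'v measure \<Rightarrow> ('o \<Rightarrow> 'v) \<Rightarrow> 'a measure \<Rightarrow> ('o \<Rightarrow> 'a) \<Rightarrow> 'b measure \<Rightarrow> ('o \<Rightarrow> 'b) \<Rightarrow> bool" where
  "markov_chain3 \<Omega> L V M X N Y \<longleftrightarrow>
     (\<forall>B\<in>sets N. AE \<omega> in \<Omega>.
        cond_prob_given \<Omega> (L \<Otimes>\<^sub>M M) (\<lambda>\<omega>. (V \<omega>, X \<omega>)) (Y -` B \<inter> space \<Omega>) \<omega>
          = cond_prob_given \<Omega> M X (Y -` B \<inter> space \<Omega>) \<omega>)"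


definition general_channel ::
    "'x measure \<Rightarrow> 'y measure \<Rightarrow> (nat \<Rightarrow> (nat \<Rightarrow> 'x) \<Rightarrow> (nat \<Rightarrow> 'y) measure) \<Rightarrow> bool" where
  "general_channel \<X> \<Y> W \<longleftrightarrow>
     (\<forall>n\<ge>1. W n \<in> block_space n \<X> \<rightarrow>\<^sub>M prob_algebra (block_space n \<Y>))"

text \<open>The decoder has to be measurable for the decoding regions to be events.  The encoder is
  arbitrary, the source blocks being countable.\<close>

definition joint_code ::
    "nat \<Rightarrow> 'v set \<Rightarrow> 'x measure \<Rightarrow> 'y measure \<Rightarrow>
      ((nat \<Rightarrow> 'v) \<Rightarrow> (nat \<Rightarrow> 'x)) \<Rightarrow> ((nat \<Rightarrow> 'y) \<Rightarrow> (nat \<Rightarrow> 'v)) \<Rightarrow> bool" where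
  "joint_code n \<V> \<X> \<Y> \<phi> \<psi> \<longleftrightarrow>
     \<phi> \<in> blocks n \<V> \<rightarrow> space (block_space n \<X>) \<and>
     \<psi> \<in> block_space n \<Y> \<rightarrow>\<^sub>M count_space (blocks n \<V>)"

definition decoding_region ::
    "nat \<Rightarrow> 'y measure \<Rightarrow> ((nat \<Rightarrow> 'y) \<Rightarrow> (nat \<Rightarrow> 'v)) \<Rightarrow> (nat \<Rightarrow> 'v) \<Rightarrow> (nat \<Rightarrow> 'y) set" where
  "decoding_region n \<Y> \<psi> v = {y \<in> space (block_space n \<Y>). \<psi> y = v}"

definition error_prob ::
    "nat \<Rightarrow> 'v set \<Rightarrow> 'y measure \<Rightarrow> (nat \<Rightarrow> 'v) measure \<Rightarrow> ((nat \<Rightarrow> 'x) \<Rightarrow> (nat \<Rightarrow> 'y) measure) \<Rightarrow>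
      ((nat \<Rightarrow> 'v) \<Rightarrow> (nat \<Rightarrow> 'x)) \<Rightarrow> ((nat \<Rightarrow> 'y) \<Rightarrow> (nat \<Rightarrow> 'v)) \<Rightarrow> real" where
  "error_prob n \<V> \<Y> P W \<phi> \<psi> =
     (\<Sum>\<^sub>\<infinity>v\<in>blocks n \<V>. measure P {v} *
        measure (W (\<phi> v)) (space (block_space n \<Y>) - decoding_region n \<Y> \<psi> v))"

text \<open>A source enters through its block distributions \<open>P n\<close>.  Blocklengths start at 1.\<close>

definition transmissible ::
    "real \<Rightarrow> 'v set \<Rightarrow> 'x measure \<Rightarrow> 'y measure \<Rightarrow> (nat \<Rightarrow> (nat \<Rightarrow> 'v) measure) \<Rightarrow>
      (nat \<Rightarrow> (nat \<Rightarrow> 'x) \<Rightarrow> (nat \<Rightarrow> 'y) measure) \<Rightarrow> bool" where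
  "transmissible \<epsilon> \<V> \<X> \<Y> P W \<longleftrightarrow>
     (\<exists>\<phi> \<psi>. (\<forall>n\<ge>1. joint_code n \<V> \<X> \<Y> (\<phi> n) (\<psi> n)) \<and>
        limsup (\<lambda>n. ereal (error_prob n \<V> \<Y> (P n) (W n) (\<phi> n) (\<psi> n))) \<le> ereal \<epsilon>)"

end

theory Submission
  imports Defs
begin

text \<open>The theorem rests on a bound for a single block length, proved by random coding with a
  threshold decoder (the method of Shannon and Feinstein, adapted to a source and a channel coded
  jointly). Write \<open>p v\<close> for the probability of the source block \<open>v\<close> and \<open>g\<close> for the derivative of
  the joint law of \<open>(X, Y)\<close> with respect to the product of its marginals. Codewords \<open>c v\<close> are
  drawn independently, \<open>c v\<close> from the law of the channel input given that the source emits \<open>v\<close>;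
  conditioning on \<open>V = v\<close> is what accommodates an input correlated with the source. The decoder
  looks for the unique \<open>v\<close> whose codeword satisfies \<open>p v * g (c v, y) > t\<close>.

  When \<open>v\<close> is sent, \<open>(v, c v)\<close> and the channel output are distributed as \<open>(V, X, Y)\<close>, because \<open>V\<close>,
  \<open>X\<close>, \<open>Y\<close> form a Markov chain. Hence the true block misses the threshold with exactly the
  probability of the event \<open>p V * g (X, Y) \<le> t\<close>. A wrong block \<open>w\<close> has a codeword independent of
  the channel output, and the output of a random block has the law of \<open>Y\<close>. Since
  \<open>\<integral> g (x, y) dP\<^sub>Y(y) \<le> 1\<close> for almost every \<open>x\<close>, Markov's inequality bounds the probability that
  \<open>w\<close> exceeds the threshold by \<open>p w / t\<close>, and summing over \<open>w\<close> costs only \<open>1 / t\<close>: weighting the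
  threshold by \<open>p w\<close> is what makes the union bound over infinitely many blocks converge. Some
  codebook is at least as good as the average, which gives \<open>joint_source_channel_coding_bound\<close>.

  With \<open>t = exp (n * \<gamma> n)\<close> the event \<open>p V * g (X, Y) \<le> t\<close> is the one in the hypothesis
  (\<open>information_threshold_iff\<close>), and \<open>1 / t\<close> tends to \<open>0\<close> because \<open>n * \<gamma> n\<close> tends to infinity.\<close>

section \<open>Integrals and sums over countable index sets\<close>

lemma emeasure_UN_le_nn_integral:
  assumes I: "countable I" and X: "\<And>i. i \<in> I \<Longrightarrow> X i \<in> sets M"
  shows "emeasure M (\<Union>i\<in>I. X i) \<le> (\<integral>\<^sup>+i. emeasure M (X i) \<partial>count_space I)"
proof -
  have "emeasure M (\<Union>i\<in>I. X i) = (\<integral>\<^sup>+x. indicator (\<Union>i\<in>I. X i) x \<partial>M)"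
    using I X by (intro nn_integral_indicator[symmetric] sets.countable_UN') auto
  also have "\<dots> \<le> (\<integral>\<^sup>+x. (\<integral>\<^sup>+i. indicator (X i) x \<partial>count_space I) \<partial>M)"
  proof (intro nn_integral_mono)
    fix x
    show "indicator (\<Union>i\<in>I. X i) x \<le> (\<integral>\<^sup>+i. indicator (X i) x \<partial>count_space I :: ennreal)"
    proof (cases "x \<in> (\<Union>i\<in>I. X i)")
      case True
      then obtain j where j: "j \<in> I" "x \<in> X j" by auto
      have "(1::ennreal) = (\<integral>\<^sup>+i. indicator {j} i \<partial>count_space I)" using j by simp
      also have "\<dots> \<le> (\<integral>\<^sup>+i. indicator (X i) x \<partial>count_space I)"
        using j by (intro nn_integral_mono) (auto simp: indicator_def)
      finally show ?thesis using True by simp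
    qed simp
  qed
  also have "\<dots> = (\<integral>\<^sup>+i. (\<integral>\<^sup>+x. indicator (X i) x \<partial>M) \<partial>count_space I)"
    using I X by (intro nn_integral_count_space_nn_integral) auto
  also have "\<dots> = (\<integral>\<^sup>+i. emeasure M (X i) \<partial>count_space I)"
    using X by (intro nn_integral_cong) simp
  finally show ?thesis .
qed

lemma borel_measurable_nn_integral_count_space:
  fixes f :: "'i \<Rightarrow> 'a \<Rightarrow> ennreal"
  assumes I: "countable I" and f: "\<And>i. i \<in> I \<Longrightarrow> f i \<in> borel_measurable M"
  shows "(\<lambda>x. \<integral>\<^sup>+i. f i x \<partial>count_space I) \<in> borel_measurable M"
proof -
  interpret sigma_finite_measure "count_space I"
    using I by (rule sigma_finite_measure_count_space_countable)
  have "(\<lambda>z. f (fst z) (snd z)) \<in> borel_measurable (count_space I \<Otimes>\<^sub>M M)"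
    using I f by (intro measurable_pair_measure_countable1) auto
  then have "(\<lambda>(x, i). f i x) \<in> borel_measurable (M \<Otimes>\<^sub>M count_space I)"
    by (subst measurable_pair_swap_iff) (simp add: case_prod_beta')
  then show ?thesis by (rule borel_measurable_nn_integral)
qed

text \<open>This is how a random choice of codebook yields a deterministic one.\<close>

lemma (in prob_space) exists_le_nn_integral:
  assumes f [measurable]: "f \<in> borel_measurable M"
  shows "\<exists>x\<in>space M. f x \<le> (\<integral>\<^sup>+x. f x \<partial>M)"
proof (rule ccontr)
  assume "\<not> ?thesis"
  then have less: "(\<integral>\<^sup>+x. f x \<partial>M) < f x" if "x \<in> space M" for x
    using that by (auto simp: not_le)
  obtain x0 where "x0 \<in> space M" using not_empty by auto
  from less[OF this] have fin: "(\<integral>\<^sup>+x. f x \<partial>M) \<noteq> \<infinity>" by auto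
  have "\<not> (AE x in M. f x \<le> (\<integral>\<^sup>+x. f x \<partial>M))"
  proof
    assume "AE x in M. f x \<le> (\<integral>\<^sup>+x. f x \<partial>M)"
    then have "AE x in M. False" using less by (auto elim!: AE_mp intro!: AE_I2 simp: not_le[symmetric])
    then show False by simp
  qed
  then have "(\<integral>\<^sup>+y. (\<integral>\<^sup>+x. f x \<partial>M) \<partial>M) < (\<integral>\<^sup>+x. f x \<partial>M)"
    using less fin by (intro nn_integral_less) (auto simp: emeasure_space_1 less_imp_le)
  then show False by (simp add: emeasure_space_1)
qed

text \<open>Transfers bounds on Lebesgue sums, where interchanges are unconditional, to the real-valued
  sum defining the error probability of a code. Summability has to be derived along the way.\<close>

lemma infsum_le_of_nn_integral_le:
  fixes f :: "'a \<Rightarrow> real"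
  assumes f: "\<And>v. v \<in> I \<Longrightarrow> 0 \<le> f v" and c: "0 \<le> c"
    and le: "(\<integral>\<^sup>+v. ennreal (f v) \<partial>count_space I) \<le> ennreal c"
  shows "(\<Sum>\<^sub>\<infinity>v\<in>I. f v) \<le> c"
proof -
  have fin: "sum f F \<le> c" if F: "finite F" "F \<subseteq> I" for F
  proof -
    have "ennreal (sum f F) = (\<integral>\<^sup>+v. ennreal (f v) \<partial>count_space F)"
      using F f by (subst nn_integral_count_space_finite) (auto simp: sum_ennreal subset_eq)
    also have "\<dots> \<le> (\<integral>\<^sup>+v. ennreal (f v) \<partial>count_space I)"
      using F by (subst (1 2) nn_integral_count_space_indicator)
        (auto intro!: nn_integral_mono simp: indicator_def)
    also have "\<dots> \<le> ennreal c" by (rule le)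
    finally show ?thesis using c by simp
  qed
  then have "f summable_on I"
    using f by (intro nonneg_bdd_above_summable_on) (auto intro!: bdd_aboveI[of _ c])
  then show ?thesis using fin by (rule infsum_le_finite_sums)
qed

section \<open>Conditional distributions\<close>

text \<open>A conditional distribution prescribes, one event \<open>B\<close> at a time, a conditional probability
  that is determined almost surely, which fixes the joint law on rectangles; rectangles form an
  intersection-stable generator, so the joint law is the semidirect product of the law of \<open>Z\<close> with
  the kernel \<open>K\<close>, written as a monadic bind.\<close>

lemma emeasure_pair_of_cond_distribution:
  assumes "prob_space \<Omega>"
    and Z [measurable]: "Z \<in> \<Omega> \<rightarrow>\<^sub>M M" and Y [measurable]: "Y \<in> \<Omega> \<rightarrow>\<^sub>M N"
    and K: "K \<in> M \<rightarrow>\<^sub>M prob_algebra N"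
    and cd: "has_cond_distribution \<Omega> M Z N Y K"
    and C: "C \<in> sets (M \<Otimes>\<^sub>M N)"
  shows "emeasure \<Omega> {\<omega> \<in> space \<Omega>. (Z \<omega>, Y \<omega>) \<in> C}
       = (\<integral>\<^sup>+\<omega>. emeasure (K (Z \<omega>)) (Pair (Z \<omega>) -` C) \<partial>\<Omega>)"
proof -
  interpret prob_space \<Omega> by fact
  have K' [measurable]: "K \<in> M \<rightarrow>\<^sub>M subprob_algebra N" using K by (rule measurable_prob_algebraD)
  have Kprob: "prob_space (K x)" and Ksets: "sets (K x) = sets N" and Kspace: "space (K x) = space N"
    if "x \<in> space M" for x
    using measurable_space[OF K that] sets_eq_imp_space_eq[of "K x" N]
    by (auto simp: space_prob_algebra)
  have Zsp: "Z \<omega> \<in> space M" if "\<omega> \<in> space \<Omega>" for \<omega> using that by (rule measurable_space[OF Z])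
  have F: "(\<lambda>x. distr (K x) (M \<Otimes>\<^sub>M N) (Pair x)) \<in> M \<rightarrow>\<^sub>M subprob_algebra (M \<Otimes>\<^sub>M N)"
    by (rule measurable_distr2[where M = N]) auto
  define \<mu> where "\<mu> = distr \<Omega> M Z \<bind> (\<lambda>x. distr (K x) (M \<Otimes>\<^sub>M N) (Pair x))"
  have ne: "space (distr \<Omega> M Z) \<noteq> {}" using not_empty Zsp by auto
  have em: "emeasure \<mu> B = (\<integral>\<^sup>+\<omega>. emeasure (K (Z \<omega>)) (Pair (Z \<omega>) -` B) \<partial>\<Omega>)"
    if B: "B \<in> sets (M \<Otimes>\<^sub>M N)" for B
  proof -
    have "emeasure \<mu> B = (\<integral>\<^sup>+x. emeasure (distr (K x) (M \<Otimes>\<^sub>M N) (Pair x)) B \<partial>distr \<Omega> M Z)"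
      unfolding \<mu>_def by (rule emeasure_bind[OF ne _ B]) (use F in simp)
    also have "\<dots> = (\<integral>\<^sup>+\<omega>. emeasure (distr (K (Z \<omega>)) (M \<Otimes>\<^sub>M N) (Pair (Z \<omega>))) B \<partial>\<Omega>)"
      using measurable_emeasure_kernel[OF F B] by (intro nn_integral_distr) auto
    also have "\<dots> = (\<integral>\<^sup>+\<omega>. emeasure (K (Z \<omega>)) (Pair (Z \<omega>) -` B) \<partial>\<Omega>)"
    proof (intro nn_integral_cong)
      fix \<omega> assume \<omega>: "\<omega> \<in> space \<Omega>"
      have "Pair (Z \<omega>) \<in> N \<rightarrow>\<^sub>M M \<Otimes>\<^sub>M N" using Zsp[OF \<omega>] by simp
      then have "Pair (Z \<omega>) \<in> K (Z \<omega>) \<rightarrow>\<^sub>M M \<Otimes>\<^sub>M N"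
        using measurable_cong_sets[OF Ksets[OF Zsp[OF \<omega>]] refl] by blast
      moreover have "Pair (Z \<omega>) -` B \<inter> space (K (Z \<omega>)) = Pair (Z \<omega>) -` B"
        using sets.sets_into_space[OF B] Kspace[OF Zsp[OF \<omega>]] by (auto simp: space_pair_measure)
      ultimately show "emeasure (distr (K (Z \<omega>)) (M \<Otimes>\<^sub>M N) (Pair (Z \<omega>))) B
          = emeasure (K (Z \<omega>)) (Pair (Z \<omega>) -` B)"
        using B by (simp add: emeasure_distr)
    qed
    finally show ?thesis .
  qed
  have rect: "emeasure \<Omega> {\<omega> \<in> space \<Omega>. Z \<omega> \<in> A \<and> Y \<omega> \<in> B}
      = (\<integral>\<^sup>+\<omega>. emeasure (K (Z \<omega>)) (Pair (Z \<omega>) -` (A \<times> B)) \<partial>\<Omega>)"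
    if A [measurable]: "A \<in> sets M" and B [measurable]: "B \<in> sets N" for A B
  proof -
    define G where "G = vimage_algebra (space \<Omega>) Z M"
    have sub: "subalgebra \<Omega> G"
      unfolding subalgebra_def G_def
      using measurable_iff_sets[of Z \<Omega> M] by auto
    interpret G: finite_measure_subalgebra \<Omega> G
      by unfold_locales (rule sub)
    let ?A = "Z -` A \<inter> space \<Omega>" and ?B = "Y -` B \<inter> space \<Omega>"
    have AG: "?A \<in> sets G" unfolding G_def by (rule in_vimage_algebra[OF A])
    have Am [measurable]: "?A \<in> sets \<Omega>" and Bm [measurable]: "?B \<in> sets \<Omega>" by measurable
    have KB [measurable]: "(\<lambda>\<omega>. measure (K (Z \<omega>)) B) \<in> borel_measurable \<Omega>"
      by (rule measurable_compose[OF Z]) measurable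
    have "measure \<Omega> (?A \<inter> ?B) = (\<integral>\<omega>\<in>?A. indicator ?B \<omega> \<partial>\<Omega>)"
      unfolding set_lebesgue_integral_def
      by (simp add: indicator_inter_arith[symmetric] Int_commute Int_left_commute)
    also have "\<dots> = (\<integral>\<omega>\<in>?A. real_cond_exp \<Omega> G (indicator ?B) \<omega> \<partial>\<Omega>)"
      by (rule G.real_cond_exp_intA[OF _ AG]) (simp add: integrable_real_indicator emeasure_eq_measure)
    also have "\<dots> = (\<integral>\<omega>\<in>?A. measure (K (Z \<omega>)) B \<partial>\<Omega>)"
      using cd B unfolding has_cond_distribution_def cond_prob_given_def G_def[symmetric]
      by (intro set_lebesgue_integral_cong_AE) auto
    also have "\<dots> = (\<integral>\<omega>. indicator ?A \<omega> * measure (K (Z \<omega>)) B \<partial>\<Omega>)"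
      unfolding set_lebesgue_integral_def by simp
    finally have m: "measure \<Omega> (?A \<inter> ?B) = (\<integral>\<omega>. indicator ?A \<omega> * measure (K (Z \<omega>)) B \<partial>\<Omega>)" .
    have le1: "AE \<omega> in \<Omega>. norm (indicator ?A \<omega> * measure (K (Z \<omega>)) B) \<le> 1"
      using Kprob Zsp by (intro AE_I2) (auto simp: indicator_def prob_space.prob_le_1)
    have int: "integrable \<Omega> (\<lambda>\<omega>. indicator ?A \<omega> * measure (K (Z \<omega>)) B)"
      by (rule integrable_const_bound[OF le1]) measurable
    have "emeasure \<Omega> (?A \<inter> ?B) = (\<integral>\<^sup>+\<omega>. ennreal (indicator ?A \<omega> * measure (K (Z \<omega>)) B) \<partial>\<Omega>)"
      using int m by (subst nn_integral_eq_integral) (auto simp: emeasure_eq_measure)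
    also have "\<dots> = (\<integral>\<^sup>+\<omega>. emeasure (K (Z \<omega>)) (Pair (Z \<omega>) -` (A \<times> B)) \<partial>\<Omega>)"
    proof (intro nn_integral_cong)
      fix \<omega> assume \<omega>: "\<omega> \<in> space \<Omega>"
      interpret Kz: prob_space "K (Z \<omega>)" using Kprob Zsp \<omega> by auto
      show "ennreal (indicator ?A \<omega> * measure (K (Z \<omega>)) B) = emeasure (K (Z \<omega>)) (Pair (Z \<omega>) -` (A \<times> B))"
        using \<omega> by (auto simp: indicator_def Kz.emeasure_eq_measure)
    qed
    also have "?A \<inter> ?B = {\<omega> \<in> space \<Omega>. Z \<omega> \<in> A \<and> Y \<omega> \<in> B}" by auto
    finally show ?thesis .
  qed
  let ?E = "{a \<times> b | a b. a \<in> sets M \<and> b \<in> sets N}"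
  have sm: "sets \<mu> = sets (M \<Otimes>\<^sub>M N)"
    unfolding \<mu>_def using ne by (intro sets_bind) simp_all
  have "distr \<Omega> (M \<Otimes>\<^sub>M N) (\<lambda>\<omega>. (Z \<omega>, Y \<omega>)) = \<mu>"
  proof (rule measure_eqI_generator_eq[OF Int_stable_pair_measure_generator[of M N],
        where \<Omega> = "space M \<times> space N" and A = "\<lambda>_. space M \<times> space N"])
    show "?E \<subseteq> Pow (space M \<times> space N)"
      using sets.space_closed[of M] sets.space_closed[of N] by auto
    show "sets (distr \<Omega> (M \<Otimes>\<^sub>M N) (\<lambda>\<omega>. (Z \<omega>, Y \<omega>))) = sigma_sets (space M \<times> space N) ?E"
      by (simp add: sets_pair_measure)
    show "sets \<mu> = sigma_sets (space M \<times> space N) ?E"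
      by (simp add: sm sets_pair_measure)
    show "range (\<lambda>_::nat. space M \<times> space N) \<subseteq> ?E" by auto
    show "(\<Union>i::nat. space M \<times> space N) = space M \<times> space N" by simp
    show "emeasure (distr \<Omega> (M \<Otimes>\<^sub>M N) (\<lambda>\<omega>. (Z \<omega>, Y \<omega>))) (space M \<times> space N) \<noteq> \<infinity>" for i :: nat
      by (subst emeasure_distr) auto
  next
    fix R assume "R \<in> ?E"
    then obtain A B where R: "R = A \<times> B" and A: "A \<in> sets M" and B: "B \<in> sets N" by auto
    have "emeasure (distr \<Omega> (M \<Otimes>\<^sub>M N) (\<lambda>\<omega>. (Z \<omega>, Y \<omega>))) R
        = emeasure \<Omega> {\<omega> \<in> space \<Omega>. Z \<omega> \<in> A \<and> Y \<omega> \<in> B}"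
      unfolding R using A B by (subst emeasure_distr) (auto intro!: arg_cong[where f = "emeasure \<Omega>"])
    also have "\<dots> = emeasure \<mu> R" using rect[OF A B] em[of R] A B R by simp
    finally show "emeasure (distr \<Omega> (M \<Otimes>\<^sub>M N) (\<lambda>\<omega>. (Z \<omega>, Y \<omega>))) R = emeasure \<mu> R" .
  qed
  then have "emeasure (distr \<Omega> (M \<Otimes>\<^sub>M N) (\<lambda>\<omega>. (Z \<omega>, Y \<omega>))) C = emeasure \<mu> C" by simp
  moreover have "emeasure (distr \<Omega> (M \<Otimes>\<^sub>M N) (\<lambda>\<omega>. (Z \<omega>, Y \<omega>))) C
      = emeasure \<Omega> {\<omega> \<in> space \<Omega>. (Z \<omega>, Y \<omega>) \<in> C}"
    using C by (subst emeasure_distr) (auto intro!: arg_cong[where f = "emeasure \<Omega>"])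
  ultimately show ?thesis using em[OF C] by simp
qed

text \<open>On null events the unconditional law is used, so that the result is always a probability
  measure and all codewords can be drawn from a single product space.\<close>

definition law_given :: "'o measure \<Rightarrow> 'a measure \<Rightarrow> ('o \<Rightarrow> 'a) \<Rightarrow> 'o set \<Rightarrow> 'a measure" where
  "law_given \<Omega> M X A =
     (if emeasure \<Omega> A = 0 then distr \<Omega> M X else distr (uniform_measure \<Omega> A) M X)"

lemma sets_law_given [simp, measurable_cong]: "sets (law_given \<Omega> M X A) = sets M"
  by (simp add: law_given_def)

lemma prob_space_law_given:
  assumes "prob_space \<Omega>" and "X \<in> \<Omega> \<rightarrow>\<^sub>M M"
  shows "prob_space (law_given \<Omega> M X A)"
proof -
  interpret prob_space \<Omega> by fact
  show ?thesis
    using assms(2) unfolding law_given_def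
    by (auto intro!: prob_space.prob_space_distr prob_space_uniform_measure prob_space_axioms)
qed

text \<open>Conditioning on an event preserves null sets, so what holds for almost every channel input
  holds for almost every codeword of each source block.\<close>

lemma AE_law_given:
  assumes "prob_space \<Omega>" and X: "X \<in> \<Omega> \<rightarrow>\<^sub>M M"
    and AE: "AE x in distr \<Omega> M X. Q x" and A: "A \<in> sets \<Omega>"
  shows "AE x in law_given \<Omega> M X A. Q x"
proof -
  from AE obtain B where B: "B \<in> null_sets (distr \<Omega> M X)" "{x \<in> space M. \<not> Q x} \<subseteq> B"
    by (auto simp: eventually_ae_filter)
  have X': "X \<in> uniform_measure \<Omega> A \<rightarrow>\<^sub>M M"
    using X by (simp cong: measurable_cong_sets)
  have BM: "B \<in> sets M" and B0: "emeasure \<Omega> (X -` B \<inter> space \<Omega>) = 0"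
    using B(1) X by (auto simp: null_sets_def emeasure_distr)
  have "emeasure (law_given \<Omega> M X A) B = 0"
  proof (cases "emeasure \<Omega> A = 0")
    case False
    have "emeasure \<Omega> (A \<inter> (X -` B \<inter> space \<Omega>)) \<le> emeasure \<Omega> (X -` B \<inter> space \<Omega>)"
      using X BM by (intro emeasure_mono) auto
    then have "emeasure \<Omega> (A \<inter> (X -` B \<inter> space \<Omega>)) = 0" using B0 by simp
    then show ?thesis
      using False X' X BM A by (simp add: law_given_def emeasure_distr measurable_sets)
  qed (use B(1) in \<open>simp add: law_given_def null_sets_def\<close>)
  then show ?thesis
    using B(2) BM by (intro AE_I[of _ _ B]) (auto simp: law_given_def)
qed

text \<open>The law of total expectation for a discrete \<open>V\<close>. Because \<open>V\<close> takes countably many values,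
  elementary conditional probabilities suffice, whatever the space of \<open>X\<close>.\<close>

lemma nn_integral_condition_discrete:
  assumes "prob_space \<Omega>" and I: "countable I"
    and V [measurable]: "V \<in> \<Omega> \<rightarrow>\<^sub>M count_space I" and X [measurable]: "X \<in> \<Omega> \<rightarrow>\<^sub>M M"
    and f: "\<And>v. v \<in> I \<Longrightarrow> f v \<in> borel_measurable M"
  shows "(\<integral>\<^sup>+\<omega>. f (V \<omega>) (X \<omega>) \<partial>\<Omega>)
       = (\<integral>\<^sup>+v. emeasure \<Omega> (V -` {v} \<inter> space \<Omega>) *
            (\<integral>\<^sup>+x. f v x \<partial>law_given \<Omega> M X (V -` {v} \<inter> space \<Omega>)) \<partial>count_space I)"
proof -
  interpret prob_space \<Omega> by fact
  let ?A = "\<lambda>v. V -` {v} \<inter> space \<Omega>"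
  have A [measurable]: "?A v \<in> sets \<Omega>" if "v \<in> I" for v
    using that by (intro measurable_sets[OF V]) auto
  have VI: "V \<omega> \<in> I" if "\<omega> \<in> space \<Omega>" for \<omega>
    using measurable_space[OF V that] by simp
  have fX: "(\<lambda>\<omega>. f v (X \<omega>)) \<in> borel_measurable \<Omega>" if "v \<in> I" for v
    using measurable_compose[OF X f[OF that]] .
  have "(\<integral>\<^sup>+\<omega>. f (V \<omega>) (X \<omega>) \<partial>\<Omega>)
      = (\<integral>\<^sup>+\<omega>. (\<integral>\<^sup>+v. f v (X \<omega>) * indicator (?A v) \<omega> \<partial>count_space I) \<partial>\<Omega>)"
  proof (intro nn_integral_cong)
    fix \<omega> assume \<omega>: "\<omega> \<in> space \<Omega>"
    have "(\<integral>\<^sup>+v. f v (X \<omega>) * indicator (?A v) \<omega> \<partial>count_space I)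
        = (\<integral>\<^sup>+v. f (V \<omega>) (X \<omega>) * indicator {V \<omega>} v \<partial>count_space I)"
      using \<omega> by (intro nn_integral_cong) (auto simp: indicator_def)
    also have "\<dots> = f (V \<omega>) (X \<omega>)"
      using VI[OF \<omega>] by (subst nn_integral_cmult_indicator) auto
    finally show "f (V \<omega>) (X \<omega>) = (\<integral>\<^sup>+v. f v (X \<omega>) * indicator (?A v) \<omega> \<partial>count_space I)" by simp
  qed
  also have "\<dots> = (\<integral>\<^sup>+v. (\<integral>\<^sup>+\<omega>. f v (X \<omega>) * indicator (?A v) \<omega> \<partial>\<Omega>) \<partial>count_space I)"
    using I fX A by (subst nn_integral_count_space_nn_integral) auto
  also have "\<dots> = (\<integral>\<^sup>+v. emeasure \<Omega> (?A v) * (\<integral>\<^sup>+x. f v x \<partial>law_given \<Omega> M X (?A v)) \<partial>count_space I)"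
  proof (intro nn_integral_cong)
    fix v assume "v \<in> space (count_space I)"
    then have v: "v \<in> I" by simp
    show "(\<integral>\<^sup>+\<omega>. f v (X \<omega>) * indicator (?A v) \<omega> \<partial>\<Omega>)
        = emeasure \<Omega> (?A v) * (\<integral>\<^sup>+x. f v x \<partial>law_given \<Omega> M X (?A v))"
    proof (cases "emeasure \<Omega> (?A v) = 0")
      case True
      then have "AE \<omega> in \<Omega>. \<omega> \<notin> ?A v" using A[OF v] by (intro AE_not_in) (simp add: null_sets_def)
      then have "(\<integral>\<^sup>+\<omega>. f v (X \<omega>) * indicator (?A v) \<omega> \<partial>\<Omega>) = (\<integral>\<^sup>+\<omega>. 0 \<partial>\<Omega>)"
        by (intro nn_integral_cong_AE) (auto simp: indicator_def)
      then show ?thesis using True by simp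
    next
      case False
      have X': "X \<in> uniform_measure \<Omega> (?A v) \<rightarrow>\<^sub>M M" by (simp cong: measurable_cong_sets)
      have "(\<integral>\<^sup>+x. f v x \<partial>law_given \<Omega> M X (?A v)) = (\<integral>\<^sup>+\<omega>. f v (X \<omega>) \<partial>uniform_measure \<Omega> (?A v))"
        using False X' f[OF v] by (simp add: law_given_def nn_integral_distr)
      also have "\<dots> = (\<integral>\<^sup>+\<omega>. f v (X \<omega>) * indicator (?A v) \<omega> \<partial>\<Omega>) / emeasure \<Omega> (?A v)"
        using fX[OF v] A[OF v] by (intro nn_integral_uniform_measure)
      finally show ?thesis
        using False emeasure_finite[of "?A v"]
        by (simp add: ennreal_times_divide mult.commute[of "emeasure \<Omega> (?A v)"] ennreal_mult_divide_eq)
    qed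
  qed
  finally show ?thesis .
qed

section \<open>Random coding\<close>

lemma distr_PiM_pair:
  assumes Q: "\<And>i. prob_space (Q i)" and ij: "i \<in> I" "j \<in> I" "i \<noteq> j"
  shows "distr (Pi\<^sub>M I Q) (Q i \<Otimes>\<^sub>M Q j) (\<lambda>c. (c i, c j)) = Q i \<Otimes>\<^sub>M Q j"
proof -
  interpret product_prob_space Q I
    using Q by (intro product_prob_spaceI)
  have [measurable]: "(\<lambda>c. (c i, c j)) \<in> Pi\<^sub>M I Q \<rightarrow>\<^sub>M Q i \<Otimes>\<^sub>M Q j"
    using ij by measurable
  have "Q i \<Otimes>\<^sub>M Q j = distr (Pi\<^sub>M I Q) (Q i \<Otimes>\<^sub>M Q j) (\<lambda>c. (c i, c j))"
  proof (rule pair_measure_eqI)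
    show "sigma_finite_measure (Q i)" "sigma_finite_measure (Q j)"
      using Q[THEN prob_space_imp_sigma_finite] by auto
    fix A B assume A: "A \<in> sets (Q i)" and B: "B \<in> sets (Q j)"
    let ?X = "\<lambda>k. if k = i then A else B"
    have "emeasure (Pi\<^sub>M I Q) {c \<in> space (Pi\<^sub>M I Q). \<forall>k\<in>{i, j}. c k \<in> ?X k}
        = (\<Prod>k\<in>{i, j}. emeasure (Q k) (?X k))"
      using ij A B by (intro emeasure_PiM_Collect) auto
    also have "\<dots> = emeasure (Q i) A * emeasure (Q j) B" using ij by simp
    also have "{c \<in> space (Pi\<^sub>M I Q). \<forall>k\<in>{i, j}. c k \<in> ?X k}
        = (\<lambda>c. (c i, c j)) -` (A \<times> B) \<inter> space (Pi\<^sub>M I Q)"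
      using ij by auto
    finally show "emeasure (Q i) A * emeasure (Q j) B
        = emeasure (distr (Pi\<^sub>M I Q) (Q i \<Otimes>\<^sub>M Q j) (\<lambda>c. (c i, c j))) (A \<times> B)"
      using A B by (simp add: emeasure_distr)
  qed simp
  then show ?thesis by simp
qed

text \<open>Points claimed by none of the sets \<open>T v\<close>, or by several, go to a fixed default index. The
  decoder is measurable because its preimages of single indices are built from countable unions of
  the sets.\<close>

lemma exists_unique_decoder:
  assumes I: "countable I" "I \<noteq> {}" and T: "\<And>v. v \<in> I \<Longrightarrow> T v \<in> sets N"
  obtains \<psi> where "\<psi> \<in> N \<rightarrow>\<^sub>M count_space I"
    and "\<And>v y. \<lbrakk>v \<in> I; y \<in> T v; \<And>w. w \<in> I - {v} \<Longrightarrow> y \<notin> T w\<rbrakk> \<Longrightarrow> \<psi> y = v"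
proof -
  obtain v0 where v0: "v0 \<in> I" using I(2) by auto
  \<comment> \<open>The outputs claimed by \<open>v\<close> alone; these sets are disjoint.\<close>
  define U where "U v = T v - (\<Union>w\<in>I - {v}. T w)" for v
  define \<psi> where "\<psi> y = (if \<exists>v\<in>I. y \<in> U v then SOME v. v \<in> I \<and> y \<in> U v else v0)" for y
  have uniq: "v = w" if "v \<in> I" "w \<in> I" "y \<in> U v" "y \<in> U w" for v w y
    using that unfolding U_def by auto
  have \<psi>U: "\<psi> y = v" if "v \<in> I" "y \<in> U v" for v y
  proof -
    have "\<exists>v. v \<in> I \<and> y \<in> U v" using that by auto
    from someI_ex[OF this] that uniq show ?thesis unfolding \<psi>_def by auto
  qed
  have U: "U v \<in> sets N" if "v \<in> I" for v
    unfolding U_def using that I T by (intro sets.Diff sets.countable_UN') auto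
  have "\<psi> \<in> N \<rightarrow>\<^sub>M count_space I"
  proof (subst measurable_count_space_eq_countable[OF I(1)], intro conjI ballI)
    show "\<psi> \<in> space N \<rightarrow> I"
      using \<psi>U v0 by (auto simp: \<psi>_def) (metis (mono_tags, lifting) someI_ex)
    fix w assume w: "w \<in> I"
    have "\<psi> -` {w} \<inter> space N = U w \<union> (if w = v0 then space N - (\<Union>v\<in>I. U v) else {})"
    proof (intro set_eqI iffI)
      fix y assume y: "y \<in> \<psi> -` {w} \<inter> space N"
      show "y \<in> U w \<union> (if w = v0 then space N - (\<Union>v\<in>I. U v) else {})"
      proof (cases "\<exists>v\<in>I. y \<in> U v")
        case True then show ?thesis using y \<psi>U by auto
      next
        case False then show ?thesis using y by (auto simp: \<psi>_def)
      qed
    next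
      fix y assume y: "y \<in> U w \<union> (if w = v0 then space N - (\<Union>v\<in>I. U v) else {})"
      then show "y \<in> \<psi> -` {w} \<inter> space N"
      proof (cases "y \<in> U w")
        case True then show ?thesis using \<psi>U[OF w True] sets.sets_into_space[OF U[OF w]] by auto
      next
        case False then show ?thesis using y by (auto simp: \<psi>_def split: if_splits)
      qed
    qed
    also have "\<dots> \<in> sets N" using U w I by (auto intro!: sets.countable_UN')
    finally show "\<psi> -` {w} \<inter> space N \<in> sets N" .
  qed
  moreover have "\<psi> y = v" if "v \<in> I" "y \<in> T v" "\<And>w. w \<in> I - {v} \<Longrightarrow> y \<notin> T w" for v y
    using that by (intro \<psi>U) (auto simp: U_def)
  ultimately show thesis using that by blast
qed

text \<open>A decoding error for \<open>v\<close> means that the output missed the target set of \<open>v\<close> or hit that of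
  another index \<open>w\<close>. Under a product measure on codebooks the codewords of \<open>v\<close> and \<open>w\<close> are
  independent; averaging the codeword of \<open>v\<close> over \<open>v\<close> then replaces the channel output by an
  independent sample from the output law \<open>R\<close>, while the codeword of \<open>w\<close> stays. The term \<open>v = w\<close> is
  added back to the second sum only to obtain \<open>R\<close> exactly.\<close>

lemma random_coding_bound:
  fixes p :: "'v \<Rightarrow> ennreal" and Q :: "'v \<Rightarrow> 'x measure" and K :: "'x \<Rightarrow> 'y measure"
  assumes I: "countable I" "I \<noteq> {}"
    and Q: "\<And>v. prob_space (Q v)" and sQ [simp, measurable_cong]: "\<And>v. sets (Q v) = sets M"
    and K: "K \<in> M \<rightarrow>\<^sub>M prob_algebra N"
    and S: "\<And>v. v \<in> I \<Longrightarrow> S v \<in> sets (M \<Otimes>\<^sub>M N)"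
    and R: "\<And>B. B \<in> sets N \<Longrightarrow>
      emeasure R B = (\<integral>\<^sup>+v. p v * (\<integral>\<^sup>+x. emeasure (K x) B \<partial>Q v) \<partial>count_space I)"
  shows "\<exists>\<phi> \<in> I \<rightarrow> space M. \<exists>\<psi> \<in> N \<rightarrow>\<^sub>M count_space I.
      (\<integral>\<^sup>+v. p v * emeasure (K (\<phi> v)) {y \<in> space N. \<psi> y \<noteq> v} \<partial>count_space I)
    \<le> (\<integral>\<^sup>+v. p v * (\<integral>\<^sup>+x. emeasure (K x) (space N - Pair x -` S v) \<partial>Q v) \<partial>count_space I)
     + (\<integral>\<^sup>+v. (\<integral>\<^sup>+x. emeasure R (Pair x -` S v) \<partial>Q v) \<partial>count_space I)"
proof -
  have K' [measurable]: "K \<in> M \<rightarrow>\<^sub>M subprob_algebra N" using K by (rule measurable_prob_algebraD)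
  have Ksets: "sets (K x) = sets N" if "x \<in> space M" for x
    using measurable_space[OF K that] by (auto simp: space_prob_algebra)
  have spQ: "space (Q v) = space M" for v using sQ by (rule sets_eq_imp_space_eq)
  have sfQ: "sigma_finite_measure (Q v)" for v
    by (rule prob_space_imp_sigma_finite[OF Q])
  interpret C: product_prob_space Q I using Q by (intro product_prob_spaceI)
  let ?P = "Pi\<^sub>M I Q"
  let ?T = "\<lambda>x v. Pair x -` S v"
  have T: "?T x v \<in> sets N" if "v \<in> I" for x v using S[OF that] by (rule sets_Pair1)
  have Tsub: "?T x v \<subseteq> space N" if "v \<in> I" for x v using T[OF that] by (rule sets.sets_into_space)
  have c_space: "c v \<in> space M" if "c \<in> space ?P" "v \<in> I" for c v
    using that by (auto simp: space_PiM spQ PiE_iff)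
  \<comment> \<open>The probabilities, for input \<open>x\<close>, that the output misses the target set that \<open>v\<close> has for the
      codeword \<open>x\<close>, and that it hits the one that \<open>v\<close> has for the codeword \<open>x'\<close>;
      \<open>J\<close> is the union bound on the error of a codebook.\<close>
  define a where "a v x = emeasure (K x) (space N - ?T x v)" for v x
  define b where "b v x' x = emeasure (K x) (?T x' v)" for v x' x
  define J where "J c = (\<integral>\<^sup>+v. p v * (a v (c v) + (\<integral>\<^sup>+w. b w (c w) (c v) \<partial>count_space (I - {v}))) \<partial>count_space I)" for c
  have a [measurable]: "a v \<in> borel_measurable M" if "v \<in> I" for v
  proof -
    have "(SIGMA x:space M. space N - ?T x v) = space (M \<Otimes>\<^sub>M N) - S v"
      by (auto simp: space_pair_measure)
    then show ?thesis unfolding a_def using S[OF that]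
      by (intro emeasure_measurable_subprob_algebra2[OF _ K']) auto
  qed
  have b: "(\<lambda>z. b v (fst z) (snd z)) \<in> borel_measurable (M \<Otimes>\<^sub>M M)" if v: "v \<in> I" for v
  proof -
    have "(\<lambda>z. (fst (fst z), snd z)) \<in> (M \<Otimes>\<^sub>M M) \<Otimes>\<^sub>M N \<rightarrow>\<^sub>M M \<Otimes>\<^sub>M N" by measurable
    from measurable_sets[OF this S[OF v]]
    have "(\<lambda>z. (fst (fst z), snd z)) -` S v \<inter> space ((M \<Otimes>\<^sub>M M) \<Otimes>\<^sub>M N) \<in> sets ((M \<Otimes>\<^sub>M M) \<Otimes>\<^sub>M N)" .
    also have "(\<lambda>z. (fst (fst z), snd z)) -` S v \<inter> space ((M \<Otimes>\<^sub>M M) \<Otimes>\<^sub>M N)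
        = (SIGMA z:space (M \<Otimes>\<^sub>M M). ?T (fst z) v)"
      using Tsub[OF v] by (auto simp: space_pair_measure)
    finally show ?thesis unfolding b_def
      by (intro emeasure_measurable_subprob_algebra2[where L = "\<lambda>z. K (snd z)" and N = N]) auto
  qed
  have bI: "(\<lambda>x'. \<integral>\<^sup>+x. b w x' x \<partial>Q v) \<in> borel_measurable M" if "w \<in> I" for v w
  proof -
    have "(\<lambda>(x', x). b w x' x) \<in> borel_measurable (M \<Otimes>\<^sub>M Q v)"
      using b[OF that] by (simp add: case_prod_beta' cong: measurable_cong_sets)
    then show ?thesis by (rule sigma_finite_measure.borel_measurable_nn_integral[OF sfQ])
  qed
  have comp [measurable]: "(\<lambda>c. c v) \<in> ?P \<rightarrow>\<^sub>M M" if "v \<in> I" for v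
    using measurable_component_singleton[OF that, of Q] measurable_cong_sets[OF refl sQ] by blast
  have am: "(\<lambda>c. a v (c v)) \<in> borel_measurable ?P" if "v \<in> I" for v
    using measurable_compose[OF comp[OF that] a[OF that]] .
  have bm: "(\<lambda>c. b w (c w) (c v)) \<in> borel_measurable ?P" if "v \<in> I" "w \<in> I" for v w
  proof -
    have "(\<lambda>c. (c w, c v)) \<in> ?P \<rightarrow>\<^sub>M M \<Otimes>\<^sub>M M" using that by measurable
    from measurable_compose[OF this b[OF that(2)]] show ?thesis by simp
  qed
  have bm': "(\<lambda>c. \<integral>\<^sup>+w. b w (c w) (c v) \<partial>count_space (I - {v})) \<in> borel_measurable ?P" if "v \<in> I" for v
    using I bm that by (intro borel_measurable_nn_integral_count_space) auto
  have Jm: "J \<in> borel_measurable ?P"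
    unfolding J_def using I am bm' by (intro borel_measurable_nn_integral_count_space) auto
  have Ea: "(\<integral>\<^sup>+c. a v (c v) \<partial>?P) = (\<integral>\<^sup>+x. a v x \<partial>Q v)" if "v \<in> I" for v
  proof -
    have "(\<integral>\<^sup>+x. a v x \<partial>distr ?P (Q v) (\<lambda>c. c v)) = (\<integral>\<^sup>+c. a v (c v) \<partial>?P)"
      using that a[OF that] by (intro nn_integral_distr) (simp_all cong: measurable_cong_sets)
    then show ?thesis using distr_PiM_component[of I Q v] Q that by simp
  qed
  have Eb: "(\<integral>\<^sup>+c. b w (c w) (c v) \<partial>?P) = (\<integral>\<^sup>+x'. (\<integral>\<^sup>+x. b w x' x \<partial>Q v) \<partial>Q w)"
    if "v \<in> I" "w \<in> I" "w \<noteq> v" for v w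
  proof -
    have bQ: "(\<lambda>z. b w (fst z) (snd z)) \<in> borel_measurable (Q w \<Otimes>\<^sub>M Q v)"
      using b[OF that(2)] by (simp cong: measurable_cong_sets)
    have "(\<integral>\<^sup>+x'. (\<integral>\<^sup>+x. b w x' x \<partial>Q v) \<partial>Q w) = (\<integral>\<^sup>+z. b w (fst z) (snd z) \<partial>(Q w \<Otimes>\<^sub>M Q v))"
      using sigma_finite_measure.nn_integral_fst[OF sfQ bQ] by simp
    also have "\<dots> = (\<integral>\<^sup>+z. b w (fst z) (snd z) \<partial>distr ?P (Q w \<Otimes>\<^sub>M Q v) (\<lambda>c. (c w, c v)))"
      using distr_PiM_pair[of Q w I v] Q that by simp
    also have "\<dots> = (\<integral>\<^sup>+c. b w (c w) (c v) \<partial>?P)"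
      using that bQ by (subst nn_integral_distr) auto
    finally show ?thesis by simp
  qed
  obtain c where c: "c \<in> space ?P" and cJ: "J c \<le> (\<integral>\<^sup>+c. J c \<partial>?P)"
    using C.P.exists_le_nn_integral[OF Jm] by auto
  have "(\<integral>\<^sup>+c. J c \<partial>?P)
      = (\<integral>\<^sup>+v. (\<integral>\<^sup>+c. p v * (a v (c v) + (\<integral>\<^sup>+w. b w (c w) (c v) \<partial>count_space (I - {v}))) \<partial>?P) \<partial>count_space I)"
    unfolding J_def using I am bm' by (intro nn_integral_count_space_nn_integral) auto
  also have "\<dots> = (\<integral>\<^sup>+v. p v * (\<integral>\<^sup>+x. a v x \<partial>Q v)
      + p v * (\<integral>\<^sup>+w. (\<integral>\<^sup>+x'. (\<integral>\<^sup>+x. b w x' x \<partial>Q v) \<partial>Q w) \<partial>count_space (I - {v})) \<partial>count_space I)"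
  proof (intro nn_integral_cong)
    fix v assume "v \<in> space (count_space I)"
    then have v: "v \<in> I" by simp
    have "(\<integral>\<^sup>+c. (\<integral>\<^sup>+w. b w (c w) (c v) \<partial>count_space (I - {v})) \<partial>?P)
        = (\<integral>\<^sup>+w. (\<integral>\<^sup>+c. b w (c w) (c v) \<partial>?P) \<partial>count_space (I - {v}))"
      using I bm v by (intro nn_integral_count_space_nn_integral) auto
    also have "\<dots> = (\<integral>\<^sup>+w. (\<integral>\<^sup>+x'. (\<integral>\<^sup>+x. b w x' x \<partial>Q v) \<partial>Q w) \<partial>count_space (I - {v}))"
      using Eb v by (intro nn_integral_cong) auto
    finally show "(\<integral>\<^sup>+c. p v * (a v (c v) + (\<integral>\<^sup>+w. b w (c w) (c v) \<partial>count_space (I - {v}))) \<partial>?P)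
      = p v * (\<integral>\<^sup>+x. a v x \<partial>Q v)
      + p v * (\<integral>\<^sup>+w. (\<integral>\<^sup>+x'. (\<integral>\<^sup>+x. b w x' x \<partial>Q v) \<partial>Q w) \<partial>count_space (I - {v}))"
      using am[OF v] bm'[OF v] Ea[OF v]
      by (simp add: nn_integral_cmult nn_integral_add distrib_left)
  qed
  also have "\<dots> = (\<integral>\<^sup>+v. p v * (\<integral>\<^sup>+x. a v x \<partial>Q v) \<partial>count_space I)
      + (\<integral>\<^sup>+v. p v * (\<integral>\<^sup>+w. (\<integral>\<^sup>+x'. (\<integral>\<^sup>+x. b w x' x \<partial>Q v) \<partial>Q w) \<partial>count_space (I - {v})) \<partial>count_space I)"
    by (intro nn_integral_add) auto
  also have "\<dots> \<le> (\<integral>\<^sup>+v. p v * (\<integral>\<^sup>+x. a v x \<partial>Q v) \<partial>count_space I)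
      + (\<integral>\<^sup>+v. (\<integral>\<^sup>+w. p v * (\<integral>\<^sup>+x'. (\<integral>\<^sup>+x. b w x' x \<partial>Q v) \<partial>Q w) \<partial>count_space I) \<partial>count_space I)"
  proof (intro add_left_mono nn_integral_mono)
    fix v
    have "(\<integral>\<^sup>+w. (\<integral>\<^sup>+x'. (\<integral>\<^sup>+x. b w x' x \<partial>Q v) \<partial>Q w) \<partial>count_space (I - {v}))
        \<le> (\<integral>\<^sup>+w. (\<integral>\<^sup>+x'. (\<integral>\<^sup>+x. b w x' x \<partial>Q v) \<partial>Q w) \<partial>count_space I)"
      by (subst (1 2) nn_integral_count_space_indicator)
         (auto intro!: nn_integral_mono simp: indicator_def)
    then show "p v * (\<integral>\<^sup>+w. (\<integral>\<^sup>+x'. (\<integral>\<^sup>+x. b w x' x \<partial>Q v) \<partial>Q w) \<partial>count_space (I - {v}))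
        \<le> (\<integral>\<^sup>+w. p v * (\<integral>\<^sup>+x'. (\<integral>\<^sup>+x. b w x' x \<partial>Q v) \<partial>Q w) \<partial>count_space I)"
      by (subst nn_integral_cmult) (auto intro: mult_left_mono)
  qed
  also have "(\<integral>\<^sup>+v. (\<integral>\<^sup>+w. p v * (\<integral>\<^sup>+x'. (\<integral>\<^sup>+x. b w x' x \<partial>Q v) \<partial>Q w) \<partial>count_space I) \<partial>count_space I)
      = (\<integral>\<^sup>+w. (\<integral>\<^sup>+v. p v * (\<integral>\<^sup>+x'. (\<integral>\<^sup>+x. b w x' x \<partial>Q v) \<partial>Q w) \<partial>count_space I) \<partial>count_space I)"
    using I by (intro nn_integral_count_space_nn_integral) auto
  also have "\<dots> = (\<integral>\<^sup>+w. (\<integral>\<^sup>+x'. emeasure R (?T x' w) \<partial>Q w) \<partial>count_space I)"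
  proof (intro nn_integral_cong)
    fix w assume "w \<in> space (count_space I)"
    then have w: "w \<in> I" by simp
    have m: "(\<lambda>x'. \<integral>\<^sup>+x. b w x' x \<partial>Q v) \<in> borel_measurable (Q w)" for v
      using bI[OF w] by (simp cong: measurable_cong_sets)
    have "(\<integral>\<^sup>+v. p v * (\<integral>\<^sup>+x'. (\<integral>\<^sup>+x. b w x' x \<partial>Q v) \<partial>Q w) \<partial>count_space I)
        = (\<integral>\<^sup>+v. (\<integral>\<^sup>+x'. p v * (\<integral>\<^sup>+x. b w x' x \<partial>Q v) \<partial>Q w) \<partial>count_space I)"
      using m by (intro nn_integral_cong) (simp add: nn_integral_cmult)
    also have "\<dots> = (\<integral>\<^sup>+x'. (\<integral>\<^sup>+v. p v * (\<integral>\<^sup>+x. b w x' x \<partial>Q v) \<partial>count_space I) \<partial>Q w)"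
      using I m by (subst nn_integral_count_space_nn_integral) auto
    also have "\<dots> = (\<integral>\<^sup>+x'. emeasure R (?T x' w) \<partial>Q w)"
      using R T[OF w] by (simp add: b_def)
    finally show "(\<integral>\<^sup>+v. p v * (\<integral>\<^sup>+x'. (\<integral>\<^sup>+x. b w x' x \<partial>Q v) \<partial>Q w) \<partial>count_space I)
        = (\<integral>\<^sup>+x'. emeasure R (?T x' w) \<partial>Q w)" .
  qed
  finally have EJ: "(\<integral>\<^sup>+c. J c \<partial>?P) \<le> (\<integral>\<^sup>+v. p v * (\<integral>\<^sup>+x. a v x \<partial>Q v) \<partial>count_space I)
      + (\<integral>\<^sup>+w. (\<integral>\<^sup>+x'. emeasure R (?T x' w) \<partial>Q w) \<partial>count_space I)" .
  obtain \<psi> where \<psi>: "\<psi> \<in> N \<rightarrow>\<^sub>M count_space I"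
    and dec: "\<And>v y. \<lbrakk>v \<in> I; y \<in> ?T (c v) v; \<And>w. w \<in> I - {v} \<Longrightarrow> y \<notin> ?T (c w) w\<rbrakk> \<Longrightarrow> \<psi> y = v"
    by (rule exists_unique_decoder[OF I, of "\<lambda>v. ?T (c v) v" N]) (use T in auto)
  have "(\<integral>\<^sup>+v. p v * emeasure (K (c v)) {y \<in> space N. \<psi> y \<noteq> v} \<partial>count_space I) \<le> J c"
    unfolding J_def
  proof (intro nn_integral_mono mult_left_mono)
    fix v assume "v \<in> space (count_space I)"
    then have v: "v \<in> I" by simp
    have sK: "sets (K (c v)) = sets N" using Ksets c_space[OF c v] by simp
    have U: "(\<Union>w\<in>I - {v}. ?T (c w) w) \<in> sets N" using I T by (intro sets.countable_UN') auto
    have "{y \<in> space N. \<psi> y \<noteq> v} \<subseteq> (space N - ?T (c v) v) \<union> (\<Union>w\<in>I - {v}. ?T (c w) w)"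
      using dec[OF v] by blast
    then have "emeasure (K (c v)) {y \<in> space N. \<psi> y \<noteq> v}
        \<le> emeasure (K (c v)) ((space N - ?T (c v) v) \<union> (\<Union>w\<in>I - {v}. ?T (c w) w))"
      using T[OF v] U by (intro emeasure_mono) (auto simp: sK)
    also have "\<dots> \<le> emeasure (K (c v)) (space N - ?T (c v) v) + emeasure (K (c v)) (\<Union>w\<in>I - {v}. ?T (c w) w)"
      using T[OF v] U by (intro emeasure_subadditive) (auto simp: sK)
    also have "\<dots> \<le> a v (c v) + (\<integral>\<^sup>+w. b w (c w) (c v) \<partial>count_space (I - {v}))"
      unfolding a_def b_def using I T
      by (intro add_left_mono emeasure_UN_le_nn_integral) (auto simp: sK)
    finally show "emeasure (K (c v)) {y \<in> space N. \<psi> y \<noteq> v}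
        \<le> a v (c v) + (\<integral>\<^sup>+w. b w (c w) (c v) \<partial>count_space (I - {v}))" .
  qed simp
  also note cJ
  also note EJ
  finally show ?thesis
    unfolding a_def using \<psi> c_space[OF c] by (intro bexI[of _ c] bexI[of _ \<psi>]) auto
qed

section \<open>The information density\<close>

text \<open>The singular part of the joint law only adds mass, so \<open>g\<close> times the product of the marginals
  lies below the joint law. If the inner integral exceeded \<open>1\<close> on a set of positive measure,
  integrating over that set would give it more mass than the marginal allows.\<close>

lemma AE_nn_integral_RN_derivative_le_1:
  assumes PX: "prob_space PX" and PY: "prob_space PY"
    and J: "sets J = sets (PX \<Otimes>\<^sub>M PY)"
    and marg: "\<And>A. A \<in> sets PX \<Longrightarrow> emeasure J (A \<times> space PY) = emeasure PX A"
    and g: "is_RN_derivative (PX \<Otimes>\<^sub>M PY) J g"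
  shows "AE x in PX. (\<integral>\<^sup>+y. g (x, y) \<partial>PY) \<le> 1"
proof -
  interpret X: prob_space PX by fact
  interpret Y: prob_space PY by fact
  have gm [measurable]: "g \<in> borel_measurable (PX \<Otimes>\<^sub>M PY)"
    using g by (simp add: is_RN_derivative_def)
  have le: "emeasure (density (PX \<Otimes>\<^sub>M PY) g) A \<le> emeasure J A" if "A \<in> sets (PX \<Otimes>\<^sub>M PY)" for A
    using g that unfolding is_RN_derivative_def by (auto intro: order_trans[rotated] simp: add_increasing2)
  define h where "h x = (\<integral>\<^sup>+y. g (x, y) \<partial>PY)" for x
  have h [measurable]: "h \<in> borel_measurable PX" unfolding h_def by measurable
  define A where "A = {x \<in> space PX. 1 < h x}"
  have A [measurable]: "A \<in> sets PX" unfolding A_def by measurable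
  have "(\<integral>\<^sup>+x. h x * indicator A x \<partial>PX) = (\<integral>\<^sup>+x. (\<integral>\<^sup>+y. g (x, y) * indicator (A \<times> space PY) (x, y) \<partial>PY) \<partial>PX)"
    unfolding h_def by (intro nn_integral_cong) (auto simp: indicator_def nn_integral_multc cong: nn_integral_cong)
  also have "\<dots> = (\<integral>\<^sup>+z. g z * indicator (A \<times> space PY) z \<partial>(PX \<Otimes>\<^sub>M PY))"
    using Y.nn_integral_fst[of "\<lambda>z. g z * indicator (A \<times> space PY) z" PX] by simp
  also have "\<dots> = emeasure (density (PX \<Otimes>\<^sub>M PY) g) (A \<times> space PY)"
    by (subst emeasure_density) auto
  also have "\<dots> \<le> emeasure J (A \<times> space PY)" by (rule le) simp
  finally have hA: "(\<integral>\<^sup>+x. h x * indicator A x \<partial>PX) \<le> emeasure PX A" by (simp add: marg)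
  have "AE x in PX. h x * indicator A x \<le> indicator A x"
  proof (rule ccontr)
    assume neg: "\<not> ?thesis"
    have "(\<integral>\<^sup>+x. indicator A x \<partial>PX) < (\<integral>\<^sup>+x. h x * indicator A x \<partial>PX)"
    proof (rule nn_integral_less)
      show "(\<integral>\<^sup>+x. indicator A x \<partial>PX) \<noteq> \<infinity>" using X.emeasure_finite[of A] by simp
      show "AE x in PX. indicator A x \<le> h x * indicator A x"
        by (auto simp: indicator_def A_def)
    qed (use neg in auto)
    then show False using hA by simp
  qed
  then show ?thesis
    unfolding h_def[symmetric]
    by (rule AE_mp) (auto intro!: AE_I2 simp: A_def indicator_def not_less split: if_splits)
qed

lemma emeasure_level_set_le:
  assumes f: "f \<in> borel_measurable M" and int: "(\<integral>\<^sup>+y. f y \<partial>M) \<le> 1" and "0 < t"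
  shows "emeasure M {y \<in> space M. ennreal t < p * f y} \<le> p * ennreal (1 / t)"
proof -
  have "{y \<in> space M. ennreal t < p * f y} \<subseteq> {y \<in> space M. 1 \<le> (p * ennreal (1 / t)) * f y}"
  proof safe
    fix y assume "ennreal t < p * f y"
    then have "ennreal t * ennreal (1 / t) \<le> p * f y * ennreal (1 / t)"
      by (intro mult_right_mono) auto
    then show "1 \<le> p * ennreal (1 / t) * f y"
      using \<open>0 < t\<close> by (simp add: ennreal_mult[symmetric] ac_simps)
  qed
  then have "emeasure M {y \<in> space M. ennreal t < p * f y}
      \<le> emeasure M {y \<in> space M. 1 \<le> (p * ennreal (1 / t)) * f y}"
    using f by (intro emeasure_mono) measurable
  also have "\<dots> \<le> (p * ennreal (1 / t)) * (\<integral>\<^sup>+y. f y * indicator (space M) y \<partial>M)"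
    using f by (intro nn_integral_Markov_inequality) auto
  also have "\<dots> \<le> (p * ennreal (1 / t)) * 1"
    using int by (intro mult_left_mono) (auto cong: nn_integral_cong)
  finally show ?thesis by simp
qed

lemma ereal_mult_le_mult_add_iff:
  fixes a b :: ereal
  assumes "0 < n"
  shows "ereal (1 / n) * a \<le> ereal (1 / n) * b + ereal c \<longleftrightarrow> a \<le> b + ereal (n * c)"
  using assms by (cases a; cases b) (auto simp: field_simps)

text \<open>Since \<open>0 * \<infinity> = 0\<close> in the extended nonnegative reals, the multiplicative form absorbs the
  degenerate cases: for \<open>q = 0\<close> both sides hold, and for \<open>u = \<infinity>\<close> and \<open>q > 0\<close> both sides fail. It
  is also the form to which Markov's inequality applies.\<close>

lemma information_threshold_iff:
  fixes u q :: ennreal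
  assumes n: "0 < n" and q: "q \<le> 1"
  shows "ereal (1 / n) * elog u \<le> ereal (1 / n) * elog (1 / q) + ereal c
     \<longleftrightarrow> \<not> ennreal (exp (n * c)) < q * u"
proof -
  show ?thesis
    unfolding ereal_mult_le_mult_add_iff[OF n]
  proof (cases "q = 0")
    case True
    then show "elog u \<le> elog (1 / q) + ereal (n * c) \<longleftrightarrow> \<not> ennreal (exp (n * c)) < q * u"
      by (simp add: elog_def ennreal_divide_zero)
  next
    case False
    then obtain r where r: "q = ennreal r" "0 < r"
      using q by (cases q) (auto simp: top_unique)
    have inv: "1 / q = ennreal (1 / r)"
      using r by (simp add: divide_ennreal[symmetric])
    show "elog u \<le> elog (1 / q) + ereal (n * c) \<longleftrightarrow> \<not> ennreal (exp (n * c)) < q * u"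
    proof (cases u)
      case top
      then show ?thesis using r inv by (simp add: elog_def ennreal_mult_top)
    next
      case (real s)
      show ?thesis
      proof (cases "s = 0")
        case True
        then show ?thesis using real by (simp add: elog_def)
      next
        case False
        then have s: "0 < s" using real by simp
        have "elog u \<le> elog (1 / q) + ereal (n * c) \<longleftrightarrow> ln s \<le> ln (1 / r) + n * c"
          using r s real inv by (simp add: elog_def)
        also have "\<dots> \<longleftrightarrow> ln (r * s) \<le> n * c"
          using r s by (simp add: ln_mult ln_div) linarith
        also have "\<dots> \<longleftrightarrow> r * s \<le> exp (n * c)"
          using r s by (metis exp_le_cancel_iff exp_ln mult_pos_pos)
        also have "\<dots> \<longleftrightarrow> \<not> ennreal (exp (n * c)) < q * u"
          using r s real by (simp add: ennreal_mult[symmetric] ennreal_less_iff not_less)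
        finally show ?thesis .
      qed
    qed
  qed
qed

section \<open>Joint source-channel coding\<close>

text \<open>The random codewords are drawn from the laws of \<open>X\<close> given \<open>V = v\<close>, with the pairs \<open>(x, y)\<close>
  exceeding the threshold for \<open>v\<close> as its target set. The Markov property turns the first sum of
  the random coding bound into the probability of the threshold event, and the weights \<open>p v\<close>
  inside the thresholds make the second sum at most \<open>1 / t\<close>.\<close>

lemma joint_source_channel_coding_bound:
  fixes g :: "'x \<times> 'y \<Rightarrow> ennreal"
  assumes "prob_space \<Omega>" and I: "countable I"
    and V [measurable]: "V \<in> \<Omega> \<rightarrow>\<^sub>M count_space I"
    and X [measurable]: "X \<in> \<Omega> \<rightarrow>\<^sub>M M" and Y [measurable]: "Y \<in> \<Omega> \<rightarrow>\<^sub>M N"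
    and K: "K \<in> M \<rightarrow>\<^sub>M prob_algebra N"
    and cd: "has_cond_distribution \<Omega> M X N Y K"
    and mc: "markov_chain3 \<Omega> (count_space I) V M X N Y"
    and RN: "is_RN_derivative (distr \<Omega> M X \<Otimes>\<^sub>M distr \<Omega> N Y)
               (distr \<Omega> (M \<Otimes>\<^sub>M N) (\<lambda>\<omega>. (X \<omega>, Y \<omega>))) g"
    and t: "0 < t"
  defines "p \<equiv> \<lambda>v. emeasure (distr \<Omega> (count_space I) V) {v}"
  shows "\<exists>\<phi> \<in> I \<rightarrow> space M. \<exists>\<psi> \<in> N \<rightarrow>\<^sub>M count_space I.
      (\<integral>\<^sup>+v. p v * emeasure (K (\<phi> v)) {y \<in> space N. \<psi> y \<noteq> v} \<partial>count_space I)
    \<le> emeasure \<Omega> {\<omega> \<in> space \<Omega>. \<not> ennreal t < p (V \<omega>) * g (X \<omega>, Y \<omega>)} + ennreal (1 / t)"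
proof -
  interpret prob_space \<Omega> by fact
  have K' [measurable]: "K \<in> M \<rightarrow>\<^sub>M subprob_algebra N" using K by (rule measurable_prob_algebraD)
  have VI: "V \<omega> \<in> I" and XM: "X \<omega> \<in> space M" if "\<omega> \<in> space \<Omega>" for \<omega>
    using measurable_space[OF V that] measurable_space[OF X that] by auto
  have ne: "I \<noteq> {}" using not_empty VI by auto
  let ?PX = "distr \<Omega> M X" and ?R = "distr \<Omega> N Y" and ?P = "distr \<Omega> (count_space I) V"
  interpret PX: prob_space ?PX using X by (rule prob_space_distr)
  interpret R: prob_space ?R using Y by (rule prob_space_distr)
  interpret P: prob_space ?P using V by (rule prob_space_distr)
  have g [measurable]: "g \<in> borel_measurable (M \<Otimes>\<^sub>M N)"
    using RN by (simp add: is_RN_derivative_def cong: measurable_cong_sets)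
  have p [measurable]: "p \<in> borel_measurable (count_space I)" by simp
  have p_eq: "p v = emeasure \<Omega> (V -` {v} \<inter> space \<Omega>)" if "v \<in> I" for v
    unfolding p_def using that by (subst emeasure_distr) auto
  define S where "S v = {z \<in> space (M \<Otimes>\<^sub>M N). ennreal t < p v * g z}" for v
  define Q where "Q v = law_given \<Omega> M X (V -` {v} \<inter> space \<Omega>)" for v
  have S [measurable]: "S v \<in> sets (M \<Otimes>\<^sub>M N)" for v unfolding S_def by measurable
  have Q: "prob_space (Q v)" for v
    unfolding Q_def by (rule prob_space_law_given[OF \<open>prob_space \<Omega>\<close> X])
  have sQ: "sets (Q v) = sets M" for v by (simp add: Q_def)
  have split: "(\<integral>\<^sup>+\<omega>. f (V \<omega>) (X \<omega>) \<partial>\<Omega>) = (\<integral>\<^sup>+v. p v * (\<integral>\<^sup>+x. f v x \<partial>Q v) \<partial>count_space I)"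
    if "\<And>v. v \<in> I \<Longrightarrow> f v \<in> borel_measurable M" for f
  proof -
    have "(\<integral>\<^sup>+\<omega>. f (V \<omega>) (X \<omega>) \<partial>\<Omega>)
        = (\<integral>\<^sup>+v. emeasure \<Omega> (V -` {v} \<inter> space \<Omega>) * (\<integral>\<^sup>+x. f v x \<partial>Q v) \<partial>count_space I)"
      unfolding Q_def
      by (rule nn_integral_condition_discrete[OF \<open>prob_space \<Omega>\<close> I V X]) (rule that)
    also have "\<dots> = (\<integral>\<^sup>+v. p v * (\<integral>\<^sup>+x. f v x \<partial>Q v) \<partial>count_space I)"
      by (intro nn_integral_cong) (simp add: p_eq)
    finally show ?thesis .
  qed
  have R: "emeasure ?R B = (\<integral>\<^sup>+v. p v * (\<integral>\<^sup>+x. emeasure (K x) B \<partial>Q v) \<partial>count_space I)"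
    if B [measurable]: "B \<in> sets N" for B
  proof -
    have "emeasure ?R B = emeasure \<Omega> {\<omega> \<in> space \<Omega>. (X \<omega>, Y \<omega>) \<in> space M \<times> B}"
      using XM by (subst emeasure_distr) (auto intro!: arg_cong[where f = "emeasure \<Omega>"])
    also have "\<dots> = (\<integral>\<^sup>+\<omega>. emeasure (K (X \<omega>)) (Pair (X \<omega>) -` (space M \<times> B)) \<partial>\<Omega>)"
      by (rule emeasure_pair_of_cond_distribution[OF \<open>prob_space \<Omega>\<close> X Y K cd]) simp
    also have "\<dots> = (\<integral>\<^sup>+\<omega>. emeasure (K (X \<omega>)) B \<partial>\<Omega>)"
      using XM by (intro nn_integral_cong arg_cong2[where f = emeasure]) auto
    also have "\<dots> = (\<integral>\<^sup>+v. p v * (\<integral>\<^sup>+x. emeasure (K x) B \<partial>Q v) \<partial>count_space I)"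
      by (rule split) measurable
    finally show ?thesis .
  qed
  have Z: "(\<lambda>\<omega>. (V \<omega>, X \<omega>)) \<in> \<Omega> \<rightarrow>\<^sub>M count_space I \<Otimes>\<^sub>M M" by measurable
  \<comment> \<open>The Markov property: given \<open>(V, X)\<close>, the output is still distributed according to \<open>K (X \<omega>)\<close>.\<close>
  have cdZ: "has_cond_distribution \<Omega> (count_space I \<Otimes>\<^sub>M M) (\<lambda>\<omega>. (V \<omega>, X \<omega>)) N Y (\<lambda>z. K (snd z))"
    unfolding has_cond_distribution_def
  proof
    fix B assume "B \<in> sets N"
    then have "AE \<omega> in \<Omega>. cond_prob_given \<Omega> M X (Y -` B \<inter> space \<Omega>) \<omega> = measure (K (X \<omega>)) B"
      and "AE \<omega> in \<Omega>. cond_prob_given \<Omega> (count_space I \<Otimes>\<^sub>M M) (\<lambda>\<omega>. (V \<omega>, X \<omega>)) (Y -` B \<inter> space \<Omega>) \<omega>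
          = cond_prob_given \<Omega> M X (Y -` B \<inter> space \<Omega>) \<omega>"
      using cd mc by (auto simp: has_cond_distribution_def markov_chain3_def)
    then show "AE \<omega> in \<Omega>. cond_prob_given \<Omega> (count_space I \<Otimes>\<^sub>M M) (\<lambda>\<omega>. (V \<omega>, X \<omega>)) (Y -` B \<inter> space \<Omega>) \<omega>
        = measure (K (snd (V \<omega>, X \<omega>))) B"
      by eventually_elim simp
  qed
  have KZ: "(\<lambda>z. K (snd z)) \<in> count_space I \<Otimes>\<^sub>M M \<rightarrow>\<^sub>M prob_algebra N"
    using K by (rule measurable_compose[OF measurable_snd])
  let ?a = "\<lambda>v x. emeasure (K x) (space N - Pair x -` S v)"
  have a: "?a v \<in> borel_measurable M" for v
  proof -
    have "(SIGMA x:space M. space N - Pair x -` S v) = space (M \<Otimes>\<^sub>M N) - S v"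
      by (auto simp: space_pair_measure)
    then show ?thesis
      by (intro emeasure_measurable_subprob_algebra2[OF _ K']) auto
  qed
  let ?C = "{w \<in> space ((count_space I \<Otimes>\<^sub>M M) \<Otimes>\<^sub>M N).
      \<not> ennreal t < p (fst (fst w)) * g (snd (fst w), snd w)}"
  have C: "?C \<in> sets ((count_space I \<Otimes>\<^sub>M M) \<Otimes>\<^sub>M N)" by measurable
  have "emeasure \<Omega> {\<omega> \<in> space \<Omega>. \<not> ennreal t < p (V \<omega>) * g (X \<omega>, Y \<omega>)}
      = emeasure \<Omega> {\<omega> \<in> space \<Omega>. ((V \<omega>, X \<omega>), Y \<omega>) \<in> ?C}"
    using VI XM measurable_space[OF Y]
    by (intro arg_cong[where f = "emeasure \<Omega>"]) (auto simp: space_pair_measure)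
  also have "\<dots> = (\<integral>\<^sup>+\<omega>. emeasure (K (snd (V \<omega>, X \<omega>))) (Pair (V \<omega>, X \<omega>) -` ?C) \<partial>\<Omega>)"
    by (rule emeasure_pair_of_cond_distribution[OF \<open>prob_space \<Omega>\<close> Z Y KZ cdZ C])
  also have "\<dots> = (\<integral>\<^sup>+\<omega>. ?a (V \<omega>) (X \<omega>) \<partial>\<Omega>)"
    using VI XM by (intro nn_integral_cong arg_cong2[where f = emeasure])
      (auto simp: S_def space_pair_measure)
  also have "\<dots> = (\<integral>\<^sup>+v. p v * (\<integral>\<^sup>+x. ?a v x \<partial>Q v) \<partial>count_space I)"
    using a by (rule split)
  finally have missed: "(\<integral>\<^sup>+v. p v * (\<integral>\<^sup>+x. ?a v x \<partial>Q v) \<partial>count_space I)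
      = emeasure \<Omega> {\<omega> \<in> space \<Omega>. \<not> ennreal t < p (V \<omega>) * g (X \<omega>, Y \<omega>)}" by simp
  have "AE x in ?PX. (\<integral>\<^sup>+y. g (x, y) \<partial>?R) \<le> 1"
  proof (rule AE_nn_integral_RN_derivative_le_1[OF PX.prob_space_axioms R.prob_space_axioms _ _ RN])
    fix A assume "A \<in> sets ?PX"
    then show "emeasure (distr \<Omega> (M \<Otimes>\<^sub>M N) (\<lambda>\<omega>. (X \<omega>, Y \<omega>))) (A \<times> space ?R) = emeasure ?PX A"
      using measurable_space[OF Y]
      by (simp add: emeasure_distr) (auto intro!: arg_cong[where f = "emeasure \<Omega>"])
  qed (simp cong: sets_pair_measure_cong)
  then have AE_Q: "AE x in Q v. (\<integral>\<^sup>+y. g (x, y) \<partial>?R) \<le> 1" if "v \<in> I" for v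
    unfolding Q_def using that V
    by (intro AE_law_given[OF \<open>prob_space \<Omega>\<close> X]) (auto intro: measurable_sets)
  have "(\<integral>\<^sup>+x. emeasure ?R (Pair x -` S v) \<partial>Q v) \<le> p v * ennreal (1 / t)" if v: "v \<in> I" for v
  proof -
    interpret Qv: prob_space "Q v" by (rule Q)
    have "(\<integral>\<^sup>+x. emeasure ?R (Pair x -` S v) \<partial>Q v) \<le> (\<integral>\<^sup>+x. p v * ennreal (1 / t) \<partial>Q v)"
    proof (intro nn_integral_mono_AE)
      have "AE x in Q v. x \<in> space M" using AE_space[of "Q v"] sets_eq_imp_space_eq[OF sQ] by simp
      moreover have "AE x in Q v. (\<integral>\<^sup>+y. g (x, y) \<partial>?R) \<le> 1" using AE_Q[OF v] .
      ultimately show "AE x in Q v. emeasure ?R (Pair x -` S v) \<le> p v * ennreal (1 / t)"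
      proof eventually_elim
        case (elim x)
        have "Pair x -` S v = {y \<in> space ?R. ennreal t < p v * g (x, y)}"
          using elim by (auto simp: S_def space_pair_measure)
        moreover have "(\<lambda>y. g (x, y)) \<in> borel_measurable ?R"
          using elim by simp
        ultimately show ?case using emeasure_level_set_le[of "\<lambda>y. g (x, y)" ?R] elim t by simp
      qed
    qed
    then show ?thesis by (simp add: Qv.emeasure_space_1)
  qed
  then have "(\<integral>\<^sup>+v. (\<integral>\<^sup>+x. emeasure ?R (Pair x -` S v) \<partial>Q v) \<partial>count_space I)
      \<le> (\<integral>\<^sup>+v. p v * ennreal (1 / t) \<partial>count_space I)"
    by (intro nn_integral_mono) simp
  also have "\<dots> = (\<integral>\<^sup>+v. p v \<partial>count_space I) * ennreal (1 / t)"
    by (intro nn_integral_multc) simp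
  also have "(\<integral>\<^sup>+v. p v \<partial>count_space I) = 1"
    unfolding p_def using emeasure_countable_singleton[of I ?P] I P.emeasure_space_1 by simp
  finally have confused: "(\<integral>\<^sup>+v. (\<integral>\<^sup>+x. emeasure ?R (Pair x -` S v) \<partial>Q v) \<partial>count_space I) \<le> ennreal (1 / t)"
    by simp
  show ?thesis
    using random_coding_bound[of I Q M K N S ?R p, OF I ne Q sQ K S R] confused
    unfolding missed by (meson add_left_mono order_trans)
qed

theorem theorem5p1:
  fixes \<V> :: "'v set" and \<X> :: "'x measure" and \<Y> :: "'y measure"
    and W :: "nat \<Rightarrow> (nat \<Rightarrow> 'x) \<Rightarrow> (nat \<Rightarrow> 'y) measure"
    and \<Omega> :: "nat \<Rightarrow> 'o measure"
    and V :: "nat \<Rightarrow> 'o \<Rightarrow> (nat \<Rightarrow> 'v)"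
    and X :: "nat \<Rightarrow> 'o \<Rightarrow> (nat \<Rightarrow> 'x)"
    and Y :: "nat \<Rightarrow> 'o \<Rightarrow> (nat \<Rightarrow> 'y)"
    and P :: "nat \<Rightarrow> (nat \<Rightarrow> 'v) measure"
    and g :: "nat \<Rightarrow> (nat \<Rightarrow> 'x) \<times> (nat \<Rightarrow> 'y) \<Rightarrow> ennreal"
    and \<gamma> :: "nat \<Rightarrow> real" and \<epsilon> :: real
  assumes "0 \<le> \<epsilon>" and "\<epsilon> < 1"
    and "countable \<V>" and "infinite \<V>"
    and "general_channel \<X> \<Y> W"
    and "\<And>n. n \<ge> 1 \<Longrightarrow> prob_space (\<Omega> n)"
    and "\<And>n. n \<ge> 1 \<Longrightarrow> V n \<in> \<Omega> n \<rightarrow>\<^sub>M count_space (blocks n \<V>)"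
    and "\<And>n. n \<ge> 1 \<Longrightarrow> P n = distr (\<Omega> n) (count_space (blocks n \<V>)) (V n)"
    and "\<And>n. n \<ge> 1 \<Longrightarrow> X n \<in> \<Omega> n \<rightarrow>\<^sub>M block_space n \<X>"
    and "\<And>n. n \<ge> 1 \<Longrightarrow> Y n \<in> \<Omega> n \<rightarrow>\<^sub>M block_space n \<Y>"
    and "\<And>n. n \<ge> 1 \<Longrightarrow>
           has_cond_distribution (\<Omega> n) (block_space n \<X>) (X n) (block_space n \<Y>) (Y n) (W n)"
    and "\<And>n. n \<ge> 1 \<Longrightarrow>
           markov_chain3 (\<Omega> n) (count_space (blocks n \<V>)) (V n)
             (block_space n \<X>) (X n) (block_space n \<Y>) (Y n)"
    and "\<And>n. n \<ge> 1 \<Longrightarrow>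
           is_RN_derivative
             (distr (\<Omega> n) (block_space n \<X>) (X n) \<Otimes>\<^sub>M distr (\<Omega> n) (block_space n \<Y>) (Y n))
             (distr (\<Omega> n) (block_space n \<X> \<Otimes>\<^sub>M block_space n \<Y>) (\<lambda>\<omega>. (X n \<omega>, Y n \<omega>)))
             (g n)"
    and "\<And>n. n \<ge> 1 \<Longrightarrow> \<gamma> n > 0"
    and "\<gamma> \<longlonglongrightarrow> 0"
    and "filterlim (\<lambda>n. real n * \<gamma> n) at_top sequentially"
    and "limsup (\<lambda>n. ereal (measure (\<Omega> n) {\<omega> \<in> space (\<Omega> n).
            ereal (1 / real n) * elog (g n (X n \<omega>, Y n \<omega>))
              \<le> ereal (1 / real n) * elog (1 / emeasure (P n) {V n \<omega>}) + ereal (\<gamma> n)}))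
          \<le> ereal \<epsilon>"
  shows "transmissible \<epsilon> \<V> \<X> \<Y> P W"
proof -
  let ?m = "\<lambda>n. measure (\<Omega> n) {\<omega> \<in> space (\<Omega> n).
      ereal (1 / real n) * elog (g n (X n \<omega>, Y n \<omega>))
        \<le> ereal (1 / real n) * elog (1 / emeasure (P n) {V n \<omega>}) + ereal (\<gamma> n)}"
  let ?e = "\<lambda>n. exp (- (real n * \<gamma> n))"
  define good where "good n \<phi> \<psi> \<longleftrightarrow> joint_code n \<V> \<X> \<Y> \<phi> \<psi>
      \<and> error_prob n \<V> \<Y> (P n) (W n) \<phi> \<psi> \<le> ?m n + ?e n" for n \<phi> \<psi>
  have "\<exists>\<phi> \<psi>. good n \<phi> \<psi>"
    if n: "n \<ge> 1" for n
  proof -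
    let ?I = "blocks n \<V>" and ?M = "block_space n \<X>" and ?N = "block_space n \<Y>"
    interpret \<Omega>: prob_space "\<Omega> n" by (rule assms(6)[OF n])
    have P: "P n = distr (\<Omega> n) (count_space ?I) (V n)" by (rule assms(8)[OF n])
    interpret P: prob_space "P n"
      unfolding P by (rule \<Omega>.prob_space_distr[OF assms(7)[OF n]])
    have I: "countable ?I"
      unfolding blocks_def using assms(3) by (intro countable_PiE) auto
    have W: "W n \<in> ?M \<rightarrow>\<^sub>M prob_algebra ?N"
      using assms(5) n by (simp add: general_channel_def)
    obtain \<phi> \<psi> where \<phi>: "\<phi> \<in> ?I \<rightarrow> space ?M" and \<psi>: "\<psi> \<in> ?N \<rightarrow>\<^sub>M count_space ?I"
      and bound: "(\<integral>\<^sup>+v. emeasure (P n) {v} * emeasure (W n (\<phi> v)) {y \<in> space ?N. \<psi> y \<noteq> v} \<partial>count_space ?I)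
        \<le> emeasure (\<Omega> n) {\<omega> \<in> space (\<Omega> n). \<not> ennreal (exp (real n * \<gamma> n))
            < emeasure (P n) {V n \<omega>} * g n (X n \<omega>, Y n \<omega>)} + ennreal (1 / exp (real n * \<gamma> n))"
      using joint_source_channel_coding_bound[OF assms(6)[OF n] I assms(7)[OF n] assms(9)[OF n]
          assms(10)[OF n] W assms(11)[OF n] assms(12)[OF n] assms(13)[OF n],
          of "exp (real n * \<gamma> n)"]
      unfolding P by auto
    have event: "{\<omega> \<in> space (\<Omega> n). \<not> ennreal (exp (real n * \<gamma> n))
            < emeasure (P n) {V n \<omega>} * g n (X n \<omega>, Y n \<omega>)}
        = {\<omega> \<in> space (\<Omega> n). ereal (1 / real n) * elog (g n (X n \<omega>, Y n \<omega>))
            \<le> ereal (1 / real n) * elog (1 / emeasure (P n) {V n \<omega>}) + ereal (\<gamma> n)}"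
      using n information_threshold_iff[of "real n", OF _ P.emeasure_le_1]
      by (intro Collect_cong conj_cong refl) simp
    have "1 / exp (real n * \<gamma> n) = ?e n" by (simp add: exp_minus inverse_eq_divide)
    with bound have "(\<integral>\<^sup>+v. emeasure (P n) {v} * emeasure (W n (\<phi> v)) {y \<in> space ?N. \<psi> y \<noteq> v} \<partial>count_space ?I)
        \<le> ennreal (?m n + ?e n)"
      unfolding event by (simp add: \<Omega>.emeasure_eq_measure)
    also have "(\<integral>\<^sup>+v. emeasure (P n) {v} * emeasure (W n (\<phi> v)) {y \<in> space ?N. \<psi> y \<noteq> v} \<partial>count_space ?I)
        = (\<integral>\<^sup>+v. ennreal (measure (P n) {v} *
            measure (W n (\<phi> v)) (space ?N - decoding_region n \<Y> \<psi> v)) \<partial>count_space ?I)"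
    proof (intro nn_integral_cong)
      fix v assume "v \<in> space (count_space ?I)"
      then have "\<phi> v \<in> space ?M" using \<phi> by auto
      from measurable_space[OF W this] interpret K: prob_space "W n (\<phi> v)"
        by (simp add: space_prob_algebra)
      have "space ?N - decoding_region n \<Y> \<psi> v = {y \<in> space ?N. \<psi> y \<noteq> v}"
        by (auto simp: decoding_region_def)
      then show "emeasure (P n) {v} * emeasure (W n (\<phi> v)) {y \<in> space ?N. \<psi> y \<noteq> v}
          = ennreal (measure (P n) {v} * measure (W n (\<phi> v)) (space ?N - decoding_region n \<Y> \<psi> v))"
        by (simp add: P.emeasure_eq_measure K.emeasure_eq_measure ennreal_mult)
    qed
    finally have "error_prob n \<V> \<Y> (P n) (W n) \<phi> \<psi> \<le> ?m n + ?e n"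
      unfolding error_prob_def by (rule infsum_le_of_nn_integral_le[rotated 2]) auto
    moreover have "joint_code n \<V> \<X> \<Y> \<phi> \<psi>"
      unfolding joint_code_def using \<phi> \<psi> by simp
    ultimately show ?thesis unfolding good_def by blast
  qed
  then obtain \<phi> \<psi> where "\<And>n. n \<ge> 1 \<Longrightarrow> good n (\<phi> n) (\<psi> n)"
    by metis
  then have code: "\<And>n. n \<ge> 1 \<Longrightarrow> joint_code n \<V> \<X> \<Y> (\<phi> n) (\<psi> n)"
    and err: "\<And>n. n \<ge> 1 \<Longrightarrow> error_prob n \<V> \<Y> (P n) (W n) (\<phi> n) (\<psi> n) \<le> ?m n + ?e n"
    unfolding good_def by blast+
  have "?e \<longlonglongrightarrow> 0"
    using assms(16) by (intro filterlim_compose[OF exp_at_bot]) (simp add: filterlim_uminus_at_bot)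
  then have "(\<lambda>n. ereal (?e n)) \<longlonglongrightarrow> ereal 0" by (simp only: lim_ereal)
  then have e0: "limsup (\<lambda>n. ereal (?e n)) = 0"
    unfolding zero_ereal_def by (rule lim_imp_Limsup[OF trivial_limit_sequentially])
  have "limsup (\<lambda>n. ereal (error_prob n \<V> \<Y> (P n) (W n) (\<phi> n) (\<psi> n)))
      \<le> limsup (\<lambda>n. ereal (?m n) + ereal (?e n))"
    using err by (intro Limsup_mono eventually_sequentiallyI[of 1]) simp
  also have "\<dots> \<le> limsup (\<lambda>n. ereal (?m n)) + limsup (\<lambda>n. ereal (?e n))"
    by (rule ereal_limsup_add_mono)
  also have "\<dots> \<le> ereal \<epsilon>"
    using assms(17) e0 by simp
  finally show ?thesis
    unfolding transmissible_def using code by blast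
qed

end
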